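(* Let $\mathcal M=(K_{i(e)},w_e,p_e)_{e\in E}$ be a Markov system on a complete metric space $(K,d)$ which is positive and contractive with a contraction rate $0<a<1$. Let $0\le\beta\le1$ and $x,y\in K_i$ for some $i\in N$. Then $$H(P_x|P_y)\le\left(B_{\beta xy}\right)^{1/2}+B_{\beta xy}.$$
   Context: Markov system. A Markov system $\mathcal M=(K_{i(e)},w_e,p_e)_{e\in E}$ on a complete metric space $(K,d)$ consists of: an at most countable set $E$; Borel measurable maps $w_e:K\to K$ and Borel measurable functions $p_e:K\to[0,1]$ ($e\in E$) with $\sum_{e\in E}p_e(x)=1$ for all $x\in K$; a partition $(K_i)_{i\in N}$ of $K$ into non-empty Borel sets; and maps $i,t:E\to N$, with $i$ surjective (so $N$ is at most countable), such that $\emptyset\neq\{p_e>0\}\subset K_{i(e)}$ and $w_e(K_{i(e)})\subset K_{t(e)}$ for all $e\in E$. It is positive if $p_e>0$ on $K_{i(e)}$ for all $e$; contractive with contraction rate $a$ ($0<a<1$) if $\sum_{e\in E,\,i(e)=j}p_e(x)d(w_ex,w_ey)\le a\,d(x,y)$ for all $x,y\in K_j$, $j\in N$. $U$ is the operator $Uf:=\sum_{e\in E}p_e\,f\circ w_e$ on non-negative Borel functions, and $U^*\nu(f):=\int Uf\,d\nu$ for Borel probability measures $\nu$ on $K$. Path measures. Let $\bar E=E\cup\{\infty\}$ be the one-point compactification of the discrete space $E$, with $w_\infty:=\mathrm{id}$, $p_\infty:=0$, and $\Sigma^+:=\bar E^{\mathbb N}$ with product topology and Borel $\sigma$-algebra;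 ${}_1[e_1,\dots,e_k]^+:=\{\sigma\in\Sigma^+:\sigma_1=e_1,\dots,\sigma_k=e_k\}$. $\Sigma_G^+:=\{\sigma\in\Sigma^+:\sigma_n\in E,\ i(\sigma_{n+1})=t(\sigma_n)\ \forall n\in\mathbb N\}$. For $x\in K$, $P_x$ is the Borel probability measure on $\Sigma^+$ with $P_x({}_1[e_1,\dots,e_k]^+)=p_{e_1}(x)p_{e_2}(w_{e_1}x)\cdots p_{e_k}(w_{e_{k-1}}\circ\cdots\circ w_{e_1}x)$. Relative entropy. For $x,y$ in the same vertex set and $n\in\mathbb N$, let $\mathcal B_n$ be the $\sigma$-algebra on $\Sigma^+$ generated by the cylinders ${}_1[e_1,\dots,e_n]^+$, let $Z_n^{xy}:=\frac{dP_x|_{\mathcal B_n}}{dP_y|_{\mathcal B_n}}$ (this exists as $\mathcal M$ is positive), $H_n(P_x|P_y):=\int Z_n^{xy}\log Z_n^{xy}\,dP_y$ with $0\log0:=0$ (non-negative and non-decreasing in $n$), and $H(P_x|P_y):=\lim_{n\to\infty}H_n(P_x|P_y)\in[0,\infty]$. The quantity $B_{\beta xy}$. For $e\in E$, $s\ge0$, let $\phi_e(s):=\sup\{|p_e(u)-p_e(v)|:u,v\in K_{i(e)},\ d(u,v)\le s\}$. For $x,y$ in the same vertex set, $j\in N$, $0\le\beta\le1$, let $$A_{xy}^{(\beta k)}:=\left\{\sigma\in\Sigma^+_G:d(w_{\sigma_k}\circ\cdots\circ w_{\sigma_1}x,\,w_{\sigma_k}\circ\cdots\circ w_{\sigma_1}y)>a^{\beta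 k}d(x,y)\right\}\quad(k\ge1),$$ and for $k=0$: $A_{xy}^{(\beta0)}:=\Sigma_G^+$ if at least one of the maps $w_e|_{K_{i(e)}}$, $e\in E$, is not a contraction (Lipschitz with constant $<1$), and $A_{xy}^{(\beta0)}:=\emptyset$ otherwise. Let $$\ell_j:=\sup_{z\in K_j}\sum_{e\in E,\,i(e)=j}\frac1{p_e(z)},\qquad \phi^{(\beta k)}_{xyj}:=\sup_{z\in K_j}\sum_{e\in E,\,i(e)=j}\frac{\phi_e^2\left(a^{\beta k}d(x,y)\right)}{p_e(z)}\quad(k\ge0),$$ $$B_{\beta xy}:=\sum_{k=0}^\infty\sum_{j\in N}\left(\ell_j\int_{A_{xy}^{(\beta k)}}1_{K_j}\left(w_{\sigma_k}\circ\cdots\circ w_{\sigma_1}(x)\right)dP_x(\sigma)+\phi^{(\beta k)}_{xyj}\,(U^* )^k\delta_x(K_j)\right).$$ For $k=0$ the empty composition is the identity and $(U^* )^0\delta_x=\delta_x$. All quantities take values in $[0,\infty]$ with $0\cdot\infty:=0$. *)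

theory Defs
  imports "HOL-Probability.Probability"
begin

section \<open>Markov systems\<close>

text \<open>
  The complete metric space \<open>K\<close> is the type \<open>'k\<close>, the at most countable edge set \<open>E\<close> is the
  type \<open>'e\<close> and the set \<open>N\<close> of vertices is the type \<open>'n\<close>.
\<close>

record ('k, 'e, 'n) markov_system =
  vset :: "'n \<Rightarrow> 'k set"
  emap :: "'e \<Rightarrow> 'k \<Rightarrow> 'k"
  eprob :: "'e \<Rightarrow> 'k \<Rightarrow> real"
  ini :: "'e \<Rightarrow> 'n"
  ter :: "'e \<Rightarrow> 'n"

definition is_markov_system ::
  "('k::complete_space, 'e::countable, 'n) markov_system \<Rightarrow> bool" where
  "is_markov_system M \<longleftrightarrow>
     (\<forall>e. emap M e \<in> borel_measurable borel) \<and>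
     (\<forall>e. eprob M e \<in> borel_measurable borel) \<and>
     (\<forall>e x. 0 \<le> eprob M e x \<and> eprob M e x \<le> 1) \<and>
     (\<forall>x. ((\<lambda>e. eprob M e x) has_sum 1) UNIV) \<and>
     (\<forall>j. vset M j \<in> sets borel \<and> vset M j \<noteq> {}) \<and>
     disjoint_family (vset M) \<and> (\<Union>j. vset M j) = UNIV \<and>
     surj (ini M) \<and>
     (\<forall>e. {x. eprob M e x > 0} \<noteq> {} \<and> {x. eprob M e x > 0} \<subseteq> vset M (ini M e)) \<and>
     (\<forall>e. emap M e ` vset M (ini M e) \<subseteq> vset M (ter M e))"

definition positive_system :: "('k, 'e, 'n) markov_system \<Rightarrow> bool" where
  "positive_system M \<longleftrightarrow> (\<forall>e. \<forall>x\<in>vset M (ini M e). eprob M e x > 0)"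

text \<open>The sum is taken in \<open>[0,\<infinity>]\<close>, so that the inequality includes its convergence.\<close>

definition contractive_system ::
  "('k::metric_space, 'e, 'n) markov_system \<Rightarrow> real \<Rightarrow> bool" where
  "contractive_system M a \<longleftrightarrow> 0 < a \<and> a < 1 \<and>
     (\<forall>j. \<forall>x\<in>vset M j. \<forall>y\<in>vset M j.
        (\<Sum>\<^sub>\<infinity>e\<in>{e. ini M e = j}. ennreal (eprob M e x * dist (emap M e x) (emap M e y)))
          \<le> ennreal (a * dist x y))"

definition markov_op ::
  "('k, 'e, 'n) markov_system \<Rightarrow> ('k \<Rightarrow> ennreal) \<Rightarrow> 'k \<Rightarrow> ennreal" where
  "markov_op M f x = (\<Sum>\<^sub>\<infinity>e. ennreal (eprob M e x) * f (emap M e x))"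

text \<open>The measure determined by \<open>U\<^sup>*\<nu>(f) = \<integral> U f d\<nu>\<close>, taken at indicator functions \<open>f\<close>.\<close>

definition markov_adj ::
  "('k::topological_space, 'e, 'n) markov_system \<Rightarrow> 'k measure \<Rightarrow> 'k measure" where
  "markov_adj M \<nu> =
     measure_of UNIV (sets borel) (\<lambda>A. \<integral>\<^sup>+x. markov_op M (indicator A) x \<partial>\<nu>)"


section \<open>Path measures\<close>

text \<open>
  \<open>None\<close> is the point at infinity. Sequences are indexed from 0, so that the \<open>n\<close>-th letter of a
  path (\<open>n \<ge> 1\<close>) is \<open>\<sigma> (n - 1)\<close>.
\<close>

definition path_topology :: "(nat \<Rightarrow> 'e option) topology" where
  "path_topology =
     product_topology (\<lambda>_. Alexandroff_compactification (discrete_topology UNIV)) UNIV"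

definition path_borel :: "(nat \<Rightarrow> 'e option) measure" where
  "path_borel = sigma (topspace path_topology) {U. openin path_topology U}"

fun emap_bar :: "('k, 'e, 'n) markov_system \<Rightarrow> 'e option \<Rightarrow> 'k \<Rightarrow> 'k" where
  "emap_bar M None x = x"
| "emap_bar M (Some e) x = emap M e x"

fun eprob_bar :: "('k, 'e, 'n) markov_system \<Rightarrow> 'e option \<Rightarrow> 'k \<Rightarrow> real" where
  "eprob_bar M None x = 0"
| "eprob_bar M (Some e) x = eprob M e x"

definition cylinder :: "'e option list \<Rightarrow> (nat \<Rightarrow> 'e option) set" where
  "cylinder es = {\<sigma> \<in> topspace path_topology. \<forall>m<length es. \<sigma> m = es ! m}"

fun path_prob :: "('k, 'e, 'n) markov_system \<Rightarrow> 'k \<Rightarrow> 'e option list \<Rightarrow> real" where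
  "path_prob M x [] = 1"
| "path_prob M x (e # es) = eprob_bar M e x * path_prob M (emap_bar M e x) es"

definition path_measure ::
  "('k, 'e, 'n) markov_system \<Rightarrow> 'k \<Rightarrow> (nat \<Rightarrow> 'e option) measure" where
  "path_measure M x = (THE P. prob_space P \<and> space P = space path_borel \<and>
     sets P = sets path_borel \<and> (\<forall>es. emeasure P (cylinder es) = ennreal (path_prob M x es)))"

text \<open>\<open>path_map M \<sigma> k\<close> is \<open>w\<^bsub>\<sigma>\<^sub>k\<^esub> \<circ> \<dots> \<circ> w\<^bsub>\<sigma>\<^sub>1\<^esub>\<close>.\<close>

primrec path_map :: "('k, 'e, 'n) markov_system \<Rightarrow> (nat \<Rightarrow> 'e option) \<Rightarrow> nat \<Rightarrow> 'k \<Rightarrow> 'k" where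
  "path_map M \<sigma> 0 x = x"
| "path_map M \<sigma> (Suc k) x = emap_bar M (\<sigma> k) (path_map M \<sigma> k x)"

definition graph_paths :: "('k, 'e, 'n) markov_system \<Rightarrow> (nat \<Rightarrow> 'e option) set" where
  "graph_paths M = {\<sigma> \<in> topspace path_topology.
     \<forall>n. \<sigma> n \<noteq> None \<and> ini M (the (\<sigma> (Suc n))) = ter M (the (\<sigma> n))}"


section \<open>Relative entropy\<close>

definition cylinder_algebra :: "nat \<Rightarrow> (nat \<Rightarrow> 'e option) measure" where
  "cylinder_algebra n = sigma (topspace path_topology) {cylinder es |es. length es = n}"

definition density_ratio ::
  "nat \<Rightarrow> (nat \<Rightarrow> 'e option) measure \<Rightarrow> (nat \<Rightarrow> 'e option) measure \<Rightarrow> (nat \<Rightarrow> 'e option) \<Rightarrow> real"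
  where
  "density_ratio n P Q \<sigma> =
     enn2real (RN_deriv (restr_to_subalg Q (cylinder_algebra n))
                        (restr_to_subalg P (cylinder_algebra n)) \<sigma>)"

text \<open>
  Integral with values in \<open>[-\<infinity>,\<infinity>]\<close>: the Bochner integral would assign 0 to a non-integrable
  \<open>Z log Z\<close>. Below, the negative part of the integrand is bounded, so no \<open>\<infinity> - \<infinity>\<close> occurs.
\<close>

definition ereal_integral :: "'a measure \<Rightarrow> ('a \<Rightarrow> real) \<Rightarrow> ereal" where
  "ereal_integral \<mu> f =
     enn2ereal (\<integral>\<^sup>+x. ennreal (f x) \<partial>\<mu>) - enn2ereal (\<integral>\<^sup>+x. ennreal (- f x) \<partial>\<mu>)"

definition entropy_upto ::
  "nat \<Rightarrow> (nat \<Rightarrow> 'e option) measure \<Rightarrow> (nat \<Rightarrow> 'e option) measure \<Rightarrow> ereal" where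
  "entropy_upto n P Q =
     ereal_integral Q (\<lambda>\<sigma>. if density_ratio n P Q \<sigma> = 0 then 0
                          else density_ratio n P Q \<sigma> * ln (density_ratio n P Q \<sigma>))"

definition relative_entropy ::
  "(nat \<Rightarrow> 'e option) measure \<Rightarrow> (nat \<Rightarrow> 'e option) measure \<Rightarrow> ereal" where
  "relative_entropy P Q = lim (\<lambda>n. entropy_upto n P Q)"


section \<open>The bound\<close>

definition modulus ::
  "('k::metric_space, 'e, 'n) markov_system \<Rightarrow> 'e \<Rightarrow> real \<Rightarrow> ennreal" where
  "modulus M e s =
     (SUP (u, v) \<in> {(u, v). u \<in> vset M (ini M e) \<and> v \<in> vset M (ini M e) \<and> dist u v \<le> s}.
        ennreal \<bar>eprob M e u - eprob M e v\<bar>)"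

definition expanding_paths ::
  "('k::metric_space, 'e, 'n) markov_system \<Rightarrow> real \<Rightarrow> real \<Rightarrow> 'k \<Rightarrow> 'k \<Rightarrow> nat
     \<Rightarrow> (nat \<Rightarrow> 'e option) set" where
  "expanding_paths M a \<beta> x y k =
     (if k = 0 then
        (if \<exists>e. \<not> (\<exists>C<1. lipschitz_on C (vset M (ini M e)) (emap M e))
         then graph_paths M else {})
      else {\<sigma> \<in> graph_paths M.
              dist (path_map M \<sigma> k x) (path_map M \<sigma> k y) > a powr (\<beta> * real k) * dist x y})"

definition inv_prob_sup :: "('k, 'e, 'n) markov_system \<Rightarrow> 'n \<Rightarrow> ennreal" where
  "inv_prob_sup M j =
     (SUP z\<in>vset M j. \<Sum>\<^sub>\<infinity>e\<in>{e. ini M e = j}. 1 / ennreal (eprob M e z))"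

definition modulus_sup ::
  "('k::metric_space, 'e, 'n) markov_system \<Rightarrow> real \<Rightarrow> real \<Rightarrow> 'k \<Rightarrow> 'k \<Rightarrow> nat \<Rightarrow> 'n \<Rightarrow> ennreal"
  where
  "modulus_sup M a \<beta> x y k j =
     (SUP z\<in>vset M j. \<Sum>\<^sub>\<infinity>e\<in>{e. ini M e = j}.
        (modulus M e (a powr (\<beta> * real k) * dist x y))\<^sup>2 / ennreal (eprob M e z))"

definition entropy_bound ::
  "('k::metric_space, 'e, 'n) markov_system \<Rightarrow> real \<Rightarrow> real \<Rightarrow> 'k \<Rightarrow> 'k \<Rightarrow> ennreal" where
  "entropy_bound M a \<beta> x y =
     (\<Sum>k. \<Sum>\<^sub>\<infinity>j.
        inv_prob_sup M j *
          (\<integral>\<^sup>+\<sigma>\<in>expanding_paths M a \<beta> x y k.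
             indicator (vset M j) (path_map M \<sigma> k x) \<partial>path_measure M x) +
        modulus_sup M a \<beta> x y k j *
          emeasure ((markov_adj M ^^ k) (return borel x)) (vset M j))"

definition ennreal_sqrt :: "ennreal \<Rightarrow> ennreal" where
  "ennreal_sqrt b = (if b = \<infinity> then \<infinity> else ennreal (sqrt (enn2real b)))"

end

theory Submission
  imports Defs
begin

text \<open>Let \<open>x\<^sub>k\<close>, \<open>y\<^sub>k\<close> be the points reached from \<open>x\<close>, \<open>y\<close> after \<open>k\<close> letters of the same path. By the
  chain rule, \<open>H(P\<^sub>x|P\<^sub>y)\<close> is the sum over \<open>k\<close> of the \<open>P\<^sub>x\<close>-expectations of the relative entropies of
  \<open>(p\<^sub>e(x\<^sub>k))\<^sub>e\<close> with respect to \<open>(p\<^sub>e(y\<^sub>k))\<^sub>e\<close>. Each of these is at most the \<open>\<chi>\<^sup>2\<close>-divergence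
  \<open>\<Sum>\<^sub>e (p\<^sub>e(x\<^sub>k) - p\<^sub>e(y\<^sub>k))\<^sup>2 / p\<^sub>e(y\<^sub>k)\<close>, in which the numerators are bounded by 1 on the expanding
  paths and by the squared moduli of continuity elsewhere. So already \<open>H(P\<^sub>x|P\<^sub>y) \<le> B\<close>, without the
  square root.\<close>

section \<open>Sums in the extended half-line\<close>

text \<open>Rewriting unordered sums as integrals over counting measures gives access to Tonelli's
  theorem. Along an enumeration of \<open>A\<close> each partial sum is a finite sum over a subset
  of \<open>A\<close>, so the sequential limit does not exceed the supremum over finite
  subsets.\<close>

lemma infsum_eq_nn_integral_count_space:
  fixes f :: "'a \<Rightarrow> ennreal"
  assumes "countable A"
  shows "infsum f A = (\<integral>\<^sup>+x. f x \<partial>count_space A)"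
proof -
  have eq: "infsum f A = (SUP F\<in>{F. finite F \<and> F \<subseteq> A}. sum f F)"
    by (intro infsumI nonneg_has_sum_complete) auto
  have le: "sum f F \<le> (\<integral>\<^sup>+x. f x \<partial>count_space A)" if "finite F" "F \<subseteq> A" for F
  proof -
    have "sum f F = (\<integral>\<^sup>+x. f x * indicator F x \<partial>count_space A)"
      using that by (subst nn_integral_count_space'[of F]) auto
    also have "\<dots> \<le> (\<integral>\<^sup>+x. f x \<partial>count_space A)"
      by (intro nn_integral_mono) (auto split: split_indicator)
    finally show ?thesis .
  qed
  have ge: "(\<integral>\<^sup>+x. f x \<partial>count_space A) \<le> infsum f A"
  proof (cases "finite A")
    case True
    then show ?thesis
      by (simp add: nn_integral_count_space_finite)
  next
    case False
    then have bij: "bij_betw (from_nat_into A) UNIV A"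
      using assms by (intro bij_betw_from_nat_into)
    have "(\<integral>\<^sup>+x. f x \<partial>count_space A) = (\<Sum>n. f (from_nat_into A n))"
      by (simp add: nn_integral_bij_count_space[OF bij, symmetric] nn_integral_count_space_nat)
    also have "\<dots> = (SUP n. \<Sum>i<n. f (from_nat_into A i))"
      by (rule suminf_eq_SUP)
    also have "\<dots> \<le> infsum f A"
    proof (rule SUP_least)
      fix n
      have "(\<Sum>i<n. f (from_nat_into A i)) = sum f (from_nat_into A ` {..<n})"
        using bij by (subst sum.reindex) (auto simp: bij_betw_def inj_on_def)
      also have "\<dots> \<le> infsum f A"
        unfolding eq using bij by (intro SUP_upper) (auto simp: bij_betw_def)
      finally show "(\<Sum>i<n. f (from_nat_into A i)) \<le> infsum f A" .
    qed
    finally show ?thesis .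
  qed
  show ?thesis
    using le by (intro antisym ge) (auto simp: eq intro!: SUP_least)
qed

text \<open>Subtraction is avoided: the entropy identities are first proved with finite terms added
  on both sides, which are then cancelled by this rule.\<close>

lemma ennreal_add_right_cancel: "a + c = b + c \<longleftrightarrow> c = \<infinity> \<or> a = b" for a b c :: ennreal
  using ennreal_add_left_cancel[of c a b] by (simp add: add.commute)

section \<open>Path space\<close>

lemma topspace_Alexandroff_UNIV:
  "topspace (Alexandroff_compactification (discrete_topology UNIV)) = UNIV"
  unfolding topspace_Alexandroff_compactification topspace_discrete_topology by (rule UNIV_option_conv[symmetric])

lemma topspace_path_topology [simp]: "topspace path_topology = UNIV"
  unfolding path_topology_def topspace_product_topology topspace_Alexandroff_UNIV by (rule PiE_UNIV)

text \<open>In this form a cylinder is a fibre of the prefix map, so that a function of the first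
  \<open>n\<close> letters can be treated as \<open>h (map \<sigma> [0..<n])\<close>.\<close>

lemma cylinder_eq: "cylinder w = {\<sigma>. map \<sigma> [0..<length w] = w}"
  unfolding cylinder_def list_eq_iff_nth_eq by simp

lemma cylinder_Nil [simp]: "cylinder [] = UNIV"
  by (simp add: cylinder_eq)

lemma openin_coordinate_preimage:
  "openin path_topology ({\<sigma>. \<sigma> m \<in> U})"
  if "openin (Alexandroff_compactification (discrete_topology UNIV)) U"
proof -
  have "continuous_map path_topology (Alexandroff_compactification (discrete_topology UNIV)) (\<lambda>\<sigma>. \<sigma> m)"
    unfolding path_topology_def by (rule continuous_map_product_projection) simp
  from openin_continuous_map_preimage[OF this that] show ?thesis
    by simp
qed

lemma sets_path_borel_open: "openin path_topology U \<Longrightarrow> U \<in> sets path_borel"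
  by (auto simp: path_borel_def)

lemma space_path_borel [simp]: "space path_borel = UNIV"
  by (simp add: path_borel_def space_measure_of_conv)

text \<open>A letter of \<open>E\<close> is an isolated point of the compactification, so the set is
  open. The point at infinity need not be isolated, but its preimage is the complement of an open
  set.\<close>

lemma sets_coordinate: "{\<sigma> :: nat \<Rightarrow> 'e option. \<sigma> m = c} \<in> sets path_borel"
proof -
  have *: "{\<sigma> :: nat \<Rightarrow> 'e option. \<sigma> m \<in> Some ` U} \<in> sets path_borel" for U
    by (intro sets_path_borel_open openin_coordinate_preimage
        openin_Alexandroff_compactification_image_Some[THEN iffD2]) simp
  show ?thesis
  proof (cases c)
    case (Some e)
    then show ?thesis using *[of "{e}"] by simp
  next
    case None
    have "{\<sigma>. \<sigma> m = c} = space path_borel - {\<sigma>. \<sigma> m \<in> range Some}"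
      using None by (auto simp: notin_range_Some)
    then show ?thesis using *[of UNIV] by (simp only: sets.compl_sets)
  qed
qed

lemma sets_cylinder [measurable]: "cylinder w \<in> sets path_borel"
proof -
  have "cylinder w = (\<Inter>m\<in>{..<length w}. {\<sigma>. \<sigma> m = w ! m}) \<inter> space path_borel"
    by (auto simp: cylinder_def)
  also have "\<dots> \<in> sets path_borel"
    by (cases "w = []") (auto intro!: sets.Int sets.countable_INT'' sets_coordinate sets.top[of path_borel, simplified]
        simp: lessThan_empty_iff)
  finally show ?thesis .
qed

text \<open>Since the alphabet is countable, the topology of \<open>\<Sigma>\<^sup>+\<close> and the finer product of the
  discrete topologies have the same Borel sets.\<close>

lemma sets_path_borel:
  "sets (path_borel :: (nat \<Rightarrow> 'e::countable option) measure) = sigma_sets UNIV (range cylinder)"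
proof
  have "U \<in> sigma_sets UNIV (range cylinder)"
    if U: "openin path_topology U" for U :: "(nat \<Rightarrow> 'e option) set"
  proof -
    \<comment> \<open>A basic neighbourhood of \<open>\<sigma>\<close> inside \<open>U\<close>
      restricts only finitely many coordinates, so it contains the cylinder of a sufficiently long
      prefix of \<open>\<sigma>\<close>.\<close>
    have *: "\<exists>n. cylinder (map \<sigma> [0..<n]) \<subseteq> U" if "\<sigma> \<in> U" for \<sigma>
    proof -
      obtain V where V: "finite {i. V i \<noteq> topspace (Alexandroff_compactification (discrete_topology (UNIV::'e set)))}"
          "\<sigma> \<in> Pi\<^sub>E UNIV V" "Pi\<^sub>E UNIV V \<subseteq> U"
        using U \<open>\<sigma> \<in> U\<close> unfolding path_topology_def openin_product_topology_alt by force
      then obtain n where n: "\<And>i. V i \<noteq> topspace (Alexandroff_compactification (discrete_topology (UNIV::'e set))) \<Longrightarrow> i < n"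
        using finite_nat_set_iff_bounded by auto
      have top: "topspace (Alexandroff_compactification (discrete_topology (UNIV::'e set))) = UNIV"
        by (auto simp: UNIV_option_conv)
      have "cylinder (map \<sigma> [0..<n]) \<subseteq> Pi\<^sub>E UNIV V"
      proof
        fix \<tau> assume \<tau>: "\<tau> \<in> cylinder (map \<sigma> [0..<n])"
        have "\<tau> i \<in> V i" for i
        proof (cases "i < n")
          case True
          then have "\<tau> i = \<sigma> i" using \<tau> by (auto simp: cylinder_def)
          then show ?thesis using V(2) by auto
        next
          case False
          then have "V i = UNIV" using n[of i] unfolding topspace_Alexandroff_UNIV by blast
          then show ?thesis by simp
        qed
        then show "\<tau> \<in> Pi\<^sub>E UNIV V" by auto
      qed
      then show ?thesis using V(3) by blast
    qed
    have "U = \<Union>{C \<in> range cylinder. C \<subseteq> U}"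
    proof -
      have self: "\<sigma> \<in> cylinder (map \<sigma> [0..<n])" for \<sigma> :: "nat \<Rightarrow> 'e option" and n
        by (simp add: cylinder_eq)
      show ?thesis
      proof (intro equalityI subsetI)
        fix \<sigma> assume "\<sigma> \<in> U"
        then obtain n where "cylinder (map \<sigma> [0..<n]) \<subseteq> U"
          using * by metis
        then show "\<sigma> \<in> \<Union>{C \<in> range cylinder. C \<subseteq> U}"
          using self[of \<sigma> n] by (intro UnionI[of "cylinder (map \<sigma> [0..<n])"]) simp_all
      qed auto
    qed
    \<comment> \<open>The union is countable because there are only countably many words over a
      countable alphabet.\<close>
    also have "\<dots> \<in> sigma_sets UNIV (range cylinder)"
      by (rule sigma_sets_UNION) (auto intro: countable_subset[OF _ countable_image[OF countableI_type]])
    finally show ?thesis .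
  qed
  then show "sets (path_borel :: (nat \<Rightarrow> 'e option) measure) \<subseteq> sigma_sets UNIV (range cylinder)"
    unfolding path_borel_def by (auto intro!: sigma_sets_mono simp: sets_measure_of_conv)
  have "sigma_sets (space path_borel) (range cylinder) \<subseteq> sets (path_borel :: (nat \<Rightarrow> 'e option) measure)"
    by (rule sets.sigma_sets_subset) auto
  then show "sigma_sets UNIV (range cylinder) \<subseteq> sets (path_borel :: (nat \<Rightarrow> 'e option) measure)"
    by simp
qed

text \<open>Either one word is a prefix of the other and the cylinders are nested, or the words
  differ at a common position and the cylinders are disjoint.\<close>

lemma cylinder_Int_cases:
  "cylinder v \<inter> cylinder w \<in> {cylinder v, cylinder w, {}}"
proof -
  have *: "cylinder v \<inter> cylinder w \<in> {cylinder w, {}}" if "length v \<le> length w" for v w :: "'a option list"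
  proof (cases "\<forall>m<length v. w ! m = v ! m")
    case True
    then have "cylinder w \<subseteq> cylinder v"
      using that by (auto simp: cylinder_def)
    then show ?thesis by auto
  next
    case False
    then have "cylinder v \<inter> cylinder w = {}"
      using that by (force simp: cylinder_def)
    then show ?thesis by simp
  qed
  show ?thesis
    using *[of v w] *[of w v] by (cases "length v \<le> length w") (auto simp: Int_commute)
qed

text \<open>Cylinders together with the empty set form an intersection-stable generator, and
  \<open>cylinder []\<close> is the whole space. This is the uniqueness behind the definite
  description in \<open>path_measure\<close>.\<close>

lemma path_measure_eqI:
  fixes P Q :: "(nat \<Rightarrow> 'e::countable option) measure"
  assumes "sets P = sets path_borel" "sets Q = sets path_borel" "prob_space P"
    and "\<And>w. emeasure P (cylinder w) = emeasure Q (cylinder w)"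
  shows "P = Q"
proof (rule measure_eqI_generator_eq[where E = "insert {} (range cylinder)" and \<Omega> = UNIV and A = "\<lambda>_. cylinder []"])
  show "Int_stable (insert {} (range cylinder :: (nat \<Rightarrow> 'e option) set set))"
  proof -
    have "cylinder v \<inter> cylinder w \<in> insert {} (range cylinder)" for v w :: "'e option list"
      using cylinder_Int_cases[of v w] by (elim insertE) (simp_all only: rangeI insertI1 insertI2 empty_iff)
    then show ?thesis
      unfolding Int_stable_def by blast
  qed
  have "sigma_sets UNIV (insert {} (range cylinder)) = sigma_sets UNIV (range cylinder :: (nat \<Rightarrow> 'e option) set set)"
    by (intro sigma_sets_eqI) (blast intro: sigma_sets.intros)+
  then show "sets P = sigma_sets UNIV (insert {} (range cylinder))"
      "sets Q = sigma_sets UNIV (insert {} (range cylinder))"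
    using assms by (simp_all add: sets_path_borel)
  interpret P: prob_space P by fact
  show "emeasure P (cylinder []) \<noteq> \<infinity>" for i :: nat
    by simp
qed (use assms in \<open>auto intro: range_eqI[of _ _ "[]"]\<close>)

lemma measurable_prefix [measurable]:
  "(\<lambda>\<sigma> :: nat \<Rightarrow> 'e::countable option. map \<sigma> [0..<n]) \<in> path_borel \<rightarrow>\<^sub>M count_space UNIV"
proof -
  have "(\<lambda>\<sigma> :: nat \<Rightarrow> 'e option. map \<sigma> [0..<n]) -` {w} \<in> sets path_borel" for w
  proof (cases "length w = n")
    case True
    then have "(\<lambda>\<sigma>. map \<sigma> [0..<n]) -` {w} = cylinder w"
      by (auto simp: cylinder_eq)
    then show ?thesis by simp
  next
    case False
    then have "(\<lambda>\<sigma>. map \<sigma> [0..<n]) -` {w} = {}" by auto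
    then show ?thesis by simp
  qed
  then show ?thesis
    by (subst measurable_count_space_eq2_countable) auto
qed

section \<open>Existence of the path measures\<close>

lemma nn_integral_count_space_option:
  fixes f :: "'e option \<Rightarrow> ennreal"
  assumes "f None = 0"
  shows "(\<integral>\<^sup>+c. f c \<partial>count_space UNIV) = (\<integral>\<^sup>+e. f (Some e) \<partial>count_space UNIV)"
proof -
  have "(\<integral>\<^sup>+c. f c \<partial>count_space UNIV) = (\<integral>\<^sup>+c. f c \<partial>count_space (range Some))"
  proof (rule nn_integral_count_space_eq)
    fix c :: "'e option" assume "c \<in> UNIV - range Some"
    then show "f c = 0" using assms by (cases c) auto
  qed simp
  also have "\<dots> = (\<integral>\<^sup>+e. f (Some e) \<partial>count_space UNIV)"
    by (rule nn_integral_bij_count_space[symmetric]) (simp add: bij_betw_def)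
  finally show ?thesis .
qed

lemma has_sum_imp_nn_integral_count_space:
  fixes f :: "'a::countable \<Rightarrow> real"
  assumes "(f has_sum s) UNIV" "\<And>x. 0 \<le> f x"
  shows "(\<integral>\<^sup>+x. ennreal (f x) \<partial>count_space UNIV) = ennreal s"
proof -
  have "(\<integral>\<^sup>+x. ennreal (f x) \<partial>count_space UNIV) = infsum (\<lambda>x. ennreal (f x)) UNIV"
    by (simp add: infsum_eq_nn_integral_count_space)
  also have "\<dots> = (SUP F\<in>{F. finite F \<and> F \<subseteq> UNIV}. \<Sum>x\<in>F. ennreal (f x))"
    by (intro infsumI nonneg_has_sum_complete) auto
  also have "\<dots> = (SUP F\<in>{F. finite F \<and> F \<subseteq> UNIV}. ennreal (sum f F))"
    using assms(2) by (intro SUP_cong refl sum_ennreal) auto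
  also have "\<dots> = ennreal (infsum f UNIV)"
    using assms by (intro infsum_nonneg_is_SUPREMUM_ennreal[symmetric]) (auto simp: summable_on_def)
  finally show ?thesis
    using assms(1) by (simp add: infsumI)
qed

lemma path_prob_append:
  "path_prob M x (v @ w) = path_prob M x v * path_prob M (fold (emap_bar M) v x) w"
  by (induction v arbitrary: x) auto

lemma path_map_eq_fold: "path_map M \<sigma> k x = fold (emap_bar M) (map \<sigma> [0..<k]) x"
  by (induction k) auto

text \<open>The function \<open>g\<close> is a tree of choices, one letter for every finite word. A
  random \<open>g\<close> will produce a random path.\<close>

primrec generated_word :: "('a list \<Rightarrow> 'a) \<Rightarrow> nat \<Rightarrow> 'a list" where
  "generated_word g 0 = []"
| "generated_word g (Suc n) = generated_word g n @ [g (generated_word g n)]"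

lemma length_generated_word [simp]: "length (generated_word g n) = n"
  by (induction n) auto

lemma map_generated_word: "map (\<lambda>m. g (generated_word g m)) [0..<n] = generated_word g n"
  by (induction n) auto

text \<open>Whether the generated path begins with \<open>w\<close> depends only on the values of
  \<open>g\<close> at the proper prefixes of \<open>w\<close>. For independent values the
  probability of this event is therefore a product.\<close>

lemma generated_word_eq_iff:
  "generated_word g (length w) = w \<longleftrightarrow> (\<forall>m<length w. g (take m w) = w ! m)"
proof (induction w rule: rev_induct)
  case (snoc c w)
  have "generated_word g (length (w @ [c])) = w @ [c] \<longleftrightarrow>
      generated_word g (length w) = w \<and> g w = c"
    by auto
  also have "\<dots> \<longleftrightarrow> (\<forall>m<length w. g (take m w) = w ! m) \<and> g w = c"
    by (simp only: snoc)
  also have "\<dots> \<longleftrightarrow> (\<forall>m<length (w @ [c]). g (take m (w @ [c])) = (w @ [c]) ! m)"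
    by (auto simp: less_Suc_eq nth_append)
  finally show ?case .
qed simp

locale markov =
  fixes M :: "('k::complete_space, 'e::countable, 'n) markov_system"
  assumes is_markov_system: "is_markov_system M"
begin

lemma
  shows measurable_emap [measurable]: "emap M e \<in> borel_measurable borel"
    and measurable_eprob [measurable]: "eprob M e \<in> borel_measurable borel"
    and eprob_nonneg: "0 \<le> eprob M e u" and eprob_le_1: "eprob M e u \<le> 1"
    and sum_eprob: "((\<lambda>e. eprob M e u) has_sum 1) UNIV"
    and sets_vset [measurable]: "vset M j \<in> sets borel"
    and disjoint_vset: "disjoint_family (vset M)"
    and surj_ini: "surj (ini M)"
    and eprob_pos_imp: "eprob M e u > 0 \<Longrightarrow> u \<in> vset M (ini M e)"
    and emap_vset: "u \<in> vset M (ini M e) \<Longrightarrow> emap M e u \<in> vset M (ter M e)"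
  using is_markov_system unfolding is_markov_system_def by (auto simp: image_subset_iff)

lemma eprob_bar_nonneg: "0 \<le> eprob_bar M c u"
  by (cases c) (auto simp: eprob_nonneg)

lemma path_prob_nonneg: "0 \<le> path_prob M u w"
  by (induction w arbitrary: u) (auto simp: eprob_bar_nonneg)

lemma countable_vertices: "countable (UNIV :: 'n set)"
  using surj_ini by (metis countableI_type countable_image)

lemma nn_integral_eprob_bar: "(\<integral>\<^sup>+c. ennreal (eprob_bar M c u) \<partial>count_space UNIV) = 1"
  by (simp add: nn_integral_count_space_option has_sum_imp_nn_integral_count_space[OF sum_eprob]
      eprob_nonneg)

definition step_pmf :: "'k \<Rightarrow> 'e option pmf" where
  "step_pmf u = embed_pmf (\<lambda>c. eprob_bar M c u)"

lemma pmf_step_pmf: "pmf (step_pmf u) c = eprob_bar M c u"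
  unfolding step_pmf_def by (rule pmf_embed_pmf) (auto simp: eprob_bar_nonneg nn_integral_eprob_bar)

text \<open>\<open>path_prob\<close> peels letters off the front, whereas the product is indexed by
  prefixes; induction from the end of the word reconciles the two.\<close>

lemma prod_step_eq_path_prob:
  "(\<Prod>m<length w. eprob_bar M (w ! m) (fold (emap_bar M) (take m w) u)) = path_prob M u w"
proof (induction w rule: rev_induct)
  case (snoc c w)
  have "(\<Prod>m<length (w @ [c]). eprob_bar M ((w @ [c]) ! m) (fold (emap_bar M) (take m (w @ [c])) u))
      = (\<Prod>m<length w. eprob_bar M (w ! m) (fold (emap_bar M) (take m w) u)) *
        eprob_bar M c (fold (emap_bar M) w u)"
    by (simp add: nth_append)
  then show ?case
    by (simp add: snoc path_prob_append)
qed simp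

text \<open>Draw one letter for every finite word independently, with the law prescribed by the point
  reached along that word, and follow the drawn letters.\<close>

lemma path_measure_exists:
  "\<exists>P. prob_space P \<and> sets P = sets path_borel \<and>
       (\<forall>w. emeasure P (cylinder w) = ennreal (path_prob M u w))"
proof -
  define L where "L v = measure_pmf (step_pmf (fold (emap_bar M) v u))" for v
  interpret product_prob_space L UNIV
    by (intro product_prob_spaceI) (simp add: L_def prob_space_measure_pmf)
  define R where "R = Pi\<^sub>M UNIV L"
  define f where "f g = (\<lambda>m. g (generated_word g m))" for g :: "'e option list \<Rightarrow> 'e option"
  have sp: "space R = UNIV"
    by (simp add: R_def space_PiM L_def)
  \<comment> \<open>The prefix \<open>v = take m w\<close> has length \<open>m\<close>, so the
    letter required of \<open>g\<close> at \<open>v\<close> is \<open>w ! length v\<close>. Only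
    finitely many coordinates of \<open>g\<close> are constrained.\<close>
  have vimage: "f -` cylinder w \<inter> space R =
      {g \<in> space R. \<forall>v\<in>(\<lambda>m. take m w) ` {..<length w}. g v \<in> {w ! length v}}" for w
    by (auto simp: sp f_def cylinder_eq map_generated_word generated_word_eq_iff)
  have [measurable]: "(\<lambda>g. g v) \<in> R \<rightarrow>\<^sub>M count_space UNIV" for v
    using measurable_component_singleton[of v UNIV L] by (simp add: R_def L_def)
  have f [measurable]: "f \<in> R \<rightarrow>\<^sub>M path_borel"
  proof (rule measurable_sigma_sets[OF sets_path_borel])
    fix C assume "C \<in> range (cylinder :: 'e option list \<Rightarrow> _)"
    then obtain w where "C = cylinder w" by auto
    then show "f -` C \<inter> space R \<in> sets R"
      by (simp only: vimage) measurable
  qed auto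
  have "emeasure (distr R path_borel f) (cylinder w) = ennreal (path_prob M u w)" for w
  proof -
    have "emeasure (distr R path_borel f) (cylinder w) =
        (\<Prod>v\<in>(\<lambda>m. take m w) ` {..<length w}. emeasure (L v) {w ! length v})"
      unfolding emeasure_distr[OF f sets_cylinder] vimage unfolding R_def
      by (intro emeasure_PiM_Collect) (auto simp: L_def)
    \<comment> \<open>Distinct \<open>m\<close> give prefixes of distinct lengths, so no factor is
      lost in passing from the set of prefixes to the index \<open>m\<close>.\<close>
    also have "\<dots> = (\<Prod>m<length w. emeasure (L (take m w)) {w ! m})"
      by (subst prod.reindex) (auto simp: inj_on_def dest: arg_cong[where f=length])
    also have "\<dots> = ennreal (path_prob M u w)"
      by (simp add: L_def emeasure_pmf_single pmf_step_pmf prod_ennreal eprob_bar_nonneg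
          prod_step_eq_path_prob)
    finally show ?thesis .
  qed
  moreover have "prob_space (distr R path_borel f)"
    unfolding R_def by (intro P.prob_space_distr f[unfolded R_def])
  ultimately show ?thesis
    by (intro exI[of _ "distr R path_borel f"]) simp
qed

text \<open>\<open>path_measure_exists\<close> and \<open>path_measure_eqI\<close> supply existence
  and uniqueness, so \<open>THE\<close> denotes the intended measure rather than an unspecified
  one.\<close>

lemma
  shows prob_space_path_measure: "prob_space (path_measure M u)"
    and sets_path_measure [measurable_cong]: "sets (path_measure M u) = sets path_borel"
    and emeasure_path_measure: "emeasure (path_measure M u) (cylinder w) = ennreal (path_prob M u w)"
proof -
  let ?Q = "\<lambda>P. prob_space P \<and> space P = space path_borel \<and>
     sets P = sets path_borel \<and> (\<forall>es. emeasure P (cylinder es) = ennreal (path_prob M u es))"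
  obtain P where "?Q P"
    using path_measure_exists[of u] sets_eq_imp_space_eq by blast
  moreover have "P' = P" if "?Q P'" for P'
    using that \<open>?Q P\<close> by (intro path_measure_eqI) auto
  ultimately have "?Q (path_measure M u)"
    unfolding path_measure_def by (rule theI)
  then show "prob_space (path_measure M u)" "sets (path_measure M u) = sets path_borel"
    "emeasure (path_measure M u) (cylinder w) = ennreal (path_prob M u w)"
    by auto
qed

end

section \<open>Integrals of functions of finitely many letters\<close>

lemma nn_integral_count_space_words_Suc:
  fixes f :: "'c list \<Rightarrow> ennreal"
  shows "(\<integral>\<^sup>+w. f w \<partial>count_space {w. length w = Suc n}) =
    (\<integral>\<^sup>+w. \<integral>\<^sup>+c. f (w @ [c]) \<partial>count_space UNIV \<partial>count_space {w. length w = n})"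
proof -
  let ?W = "{w :: 'c list. length w = n}"
  have "bij_betw (\<lambda>(w, c). w @ [c]) (?W \<times> UNIV) {w. length w = Suc n}"
    by (rule bij_betw_byWitness[where f' = "\<lambda>w. (butlast w, last w)"])
      (auto simp: append_butlast_last_id length_0_conv[symmetric] simp del: length_0_conv)
  then have "(\<integral>\<^sup>+w. f w \<partial>count_space {w. length w = Suc n}) =
      (\<integral>\<^sup>+z. f (case z of (w, c) \<Rightarrow> w @ [c]) \<partial>count_space (?W \<times> UNIV))"
    by (rule nn_integral_bij_count_space[symmetric])
  \<comment> \<open>The length restriction becomes an indicator so that Tonelli can be applied to
    counting measures on full types.\<close>
  also have "\<dots> = (\<integral>\<^sup>+z. f (fst z @ [snd z]) * indicator ?W (fst z) \<partial>count_space UNIV)"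
    by (auto simp: nn_integral_count_space_indicator split_beta intro!: nn_integral_cong split: split_indicator)
  also have "\<dots> = (\<integral>\<^sup>+w. \<integral>\<^sup>+c. f (w @ [c]) * indicator ?W w \<partial>count_space UNIV \<partial>count_space UNIV)"
    by (subst nn_integral_fst_count_space[symmetric]) simp
  also have "\<dots> = (\<integral>\<^sup>+w. \<integral>\<^sup>+c. f (w @ [c]) \<partial>count_space UNIV \<partial>count_space ?W)"
    by (auto simp: nn_integral_count_space_indicator intro!: nn_integral_cong split: split_indicator)
  finally show ?thesis .
qed

text \<open>Words form a countable discrete space, so every \<open>h\<close> with values in
  \<open>N\<close> is measurable on it.\<close>

lemma measurable_of_prefix:
  "(\<lambda>\<sigma> :: nat \<Rightarrow> 'e::countable option. h (map \<sigma> [0..<n])) \<in> path_borel \<rightarrow>\<^sub>M N"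
  if "\<And>w. h w \<in> space N"
  using that by (intro measurable_compose[OF measurable_prefix]) (auto simp: Pi_iff)

lemma measurable_path_map [measurable]:
  fixes M :: "('k::topological_space, 'e::countable, 'n) markov_system"
  shows "(\<lambda>\<sigma>. path_map M \<sigma> n u) \<in> path_borel \<rightarrow>\<^sub>M borel"
  unfolding path_map_eq_fold by (intro measurable_of_prefix) auto

context markov
begin

text \<open>The integrand is constant on each cylinder of length \<open>n\<close>. It is a countable
  combination of indicators of these cylinders and is integrated term by term.\<close>

lemma nn_integral_prefix:
  "(\<integral>\<^sup>+\<sigma>. h (map \<sigma> [0..<n]) \<partial>path_measure M u) =
    (\<integral>\<^sup>+w. ennreal (path_prob M u w) * h w \<partial>count_space {w. length w = n})"
proof -
  have "h (map \<sigma> [0..<n]) =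
      (\<integral>\<^sup>+w. h w * indicator (cylinder w) \<sigma> \<partial>count_space {w. length w = n})" for \<sigma>
    by (subst nn_integral_count_space'[of "{map \<sigma> [0..<n]}"])
      (auto simp: cylinder_eq split: split_indicator)
  then have "(\<integral>\<^sup>+\<sigma>. h (map \<sigma> [0..<n]) \<partial>path_measure M u) =
      (\<integral>\<^sup>+\<sigma>. \<integral>\<^sup>+w. h w * indicator (cylinder w) \<sigma> \<partial>count_space {w. length w = n} \<partial>path_measure M u)"
    by simp
  also have "\<dots> =
      (\<integral>\<^sup>+w. \<integral>\<^sup>+\<sigma>. h w * indicator (cylinder w) \<sigma> \<partial>path_measure M u \<partial>count_space {w. length w = n})"
    by (rule nn_integral_count_space_nn_integral) auto
  also have "\<dots> = (\<integral>\<^sup>+w. ennreal (path_prob M u w) * h w \<partial>count_space {w. length w = n})"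
    by (intro nn_integral_cong, subst nn_integral_cmult_indicator)
      (auto simp: emeasure_path_measure mult.commute sets_path_measure)
  finally show ?thesis .
qed

text \<open>This is the Markov property: given the first \<open>n\<close> letters, the next letter
  is distributed according to the probabilities at the point reached so far.\<close>

lemma nn_integral_prefix_Suc:
  "(\<integral>\<^sup>+\<sigma>. h (map \<sigma> [0..<Suc n]) \<partial>path_measure M u) =
    (\<integral>\<^sup>+\<sigma>. \<integral>\<^sup>+c. ennreal (eprob_bar M c (path_map M \<sigma> n u)) * h (map \<sigma> [0..<n] @ [c])
       \<partial>count_space UNIV \<partial>path_measure M u)"
  unfolding path_map_eq_fold
  by (subst nn_integral_prefix, subst nn_integral_prefix[where
        h = "\<lambda>w. \<integral>\<^sup>+c. ennreal (eprob_bar M c (fold (emap_bar M) w u)) * h (w @ [c]) \<partial>count_space UNIV"])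
    (auto simp: nn_integral_count_space_words_Suc path_prob_append path_prob_nonneg eprob_bar_nonneg
      ennreal_mult mult.assoc nn_integral_cmult)

section \<open>The Markov operator and the law of the point after \<open>k\<close> steps\<close>

lemma markov_op_eq_nn_integral:
  "markov_op M f u = (\<integral>\<^sup>+e. ennreal (eprob M e u) * f (emap M e u) \<partial>count_space UNIV)"
  by (simp add: markov_op_def infsum_eq_nn_integral_count_space)

lemma measurable_markov_op [measurable]:
  assumes [measurable]: "f \<in> borel_measurable borel"
  shows "markov_op M f \<in> borel_measurable borel"
proof -
  interpret sigma_finite_measure "count_space (UNIV :: 'e set)"
    by (simp add: sigma_finite_measure_count_space)
  have "(\<lambda>z. ennreal (eprob M (snd z) (fst z)) * f (emap M (snd z) (fst z)))
      \<in> borel_measurable (borel \<Otimes>\<^sub>M count_space UNIV)"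
    by (rule measurable_compose_countable[where g = snd and
          f = "\<lambda>e z. ennreal (eprob M e (fst z)) * f (emap M e (fst z))"]) measurable
  then show ?thesis
    unfolding markov_op_eq_nn_integral[abs_def]
    by (intro borel_measurable_nn_integral) (simp add: split_beta')
qed

text \<open>The induction step is the Markov property applied to indicators. It turns the weights
  given by iterates of \<open>markov_adj\<close> in the bound into probabilities under the path
  measure.\<close>

lemma markov_adj_iterate:
  "(markov_adj M ^^ k) (return borel u) = distr (path_measure M u) borel (\<lambda>\<sigma>. path_map M \<sigma> k u)"
proof (induction k)
  case 0
  interpret prob_space "path_measure M u" by (rule prob_space_path_measure)
  show ?case by (simp add: distr_const)
next
  case (Suc k)
  let ?D = "distr (path_measure M u) borel (\<lambda>\<sigma>. path_map M \<sigma> (Suc k) u)"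
  have "(\<integral>\<^sup>+v. markov_op M (indicator A) v \<partial>distr (path_measure M u) borel (\<lambda>\<sigma>. path_map M \<sigma> k u))
      = emeasure ?D A" if [measurable]: "A \<in> sets borel" for A
  proof -
    have "(\<integral>\<^sup>+v. markov_op M (indicator A) v \<partial>distr (path_measure M u) borel (\<lambda>\<sigma>. path_map M \<sigma> k u))
        = (\<integral>\<^sup>+\<sigma>. markov_op M (indicator A) (path_map M \<sigma> k u) \<partial>path_measure M u)"
      by (rule nn_integral_distr) auto
    also have "\<dots> = (\<integral>\<^sup>+\<sigma>. \<integral>\<^sup>+c. ennreal (eprob_bar M c (path_map M \<sigma> k u)) *
        indicator A (fold (emap_bar M) (map \<sigma> [0..<k] @ [c]) u) \<partial>count_space UNIV \<partial>path_measure M u)"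
      by (simp add: nn_integral_count_space_option markov_op_eq_nn_integral path_map_eq_fold)
    also have "\<dots> = (\<integral>\<^sup>+\<sigma>. indicator A (path_map M \<sigma> (Suc k) u) \<partial>path_measure M u)"
      unfolding path_map_eq_fold[of M _ "Suc k"]
      by (rule nn_integral_prefix_Suc[symmetric])
    also have "\<dots> = (\<integral>\<^sup>+v. indicator A v \<partial>?D)"
      by (rule nn_integral_distr[symmetric]) (auto simp del: path_map.simps)
    finally show ?thesis
      by simp
  qed
  \<comment> \<open>On Borel sets the set function in \<open>markov_adj\<close> agrees with the
    measure \<open>?D\<close>; hence \<open>measure_of\<close> does not fall back to its default,
    the zero measure.\<close>
  then have "markov_adj M (distr (path_measure M u) borel (\<lambda>\<sigma>. path_map M \<sigma> k u)) =
      measure_of (space ?D) (sets ?D) (emeasure ?D)"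
    unfolding markov_adj_def space_distr sets_distr space_borel
    by (intro measure_of_eq) (auto simp: sets.sigma_sets_eq[of borel, simplified])
  then show ?case
    by (simp only: funpow.simps comp_def Suc.IH measure_of_of_measure)
qed

end

section \<open>The entropy integrand\<close>

text \<open>Adding \<open>t - s\<close> to \<open>s ln (s/t)\<close> does not change the integral, since both densities have
  mass 1, and makes the integrand non-negative, so that all sums can be taken in \<open>[0,\<infinity>]\<close>.\<close>

definition entropy_term :: "real \<Rightarrow> real \<Rightarrow> real" where
  "entropy_term s t = s * ln (s / t) - s + t"

lemma entropy_term_0_0 [simp]: "entropy_term 0 0 = 0"
  by (simp add: entropy_term_def)

lemma entropy_term_self [simp]: "entropy_term s s = 0"
  by (simp add: entropy_term_def)

text \<open>This is \<open>ln r \<le> r - 1\<close> at \<open>r = t / s\<close>, multiplied by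
  \<open>s\<close>.\<close>

lemma entropy_term_nonneg:
  assumes "0 < s" "0 < t"
  shows "0 \<le> entropy_term s t"
proof -
  have "ln (t / s) \<le> t / s - 1"
    using assms by (intro ln_le_minus_one) simp
  then have "s * ln (t / s) \<le> s * (t / s - 1)"
    using assms by (intro mult_left_mono) auto
  then show ?thesis
    using assms by (simp add: entropy_term_def ln_div algebra_simps)
qed

text \<open>The inequality \<open>ln r \<le> r - 1\<close>, now at \<open>r = s / t\<close>, gives
  the chi-square term, since \<open>s * (s / t - 1) - s + t = (s - t)\<^sup>2 / t\<close>.\<close>

lemma entropy_term_le:
  assumes "0 < s" "0 < t"
  shows "entropy_term s t \<le> (s - t)\<^sup>2 / t"
proof -
  have "ln (s / t) \<le> s / t - 1"
    using assms by (intro ln_le_minus_one) simp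
  then have "s * ln (s / t) \<le> s * (s / t - 1)"
    using assms by (intro mult_left_mono) auto
  then show ?thesis
    using assms by (simp add: entropy_term_def field_simps power2_eq_square)
qed

text \<open>The logarithm of the product splits. The linear terms are distributed over the two sides
  so that nothing is subtracted; when \<open>s\<close> and \<open>t\<close> run through two
  probability vectors, they sum to \<open>q + p\<close> on either side.\<close>

lemma entropy_term_mult:
  assumes "0 < p" "0 < q" "0 < s" "0 < t"
  shows "s * entropy_term p q + p * entropy_term s t + q * t + p * s =
    entropy_term (p * s) (q * t) + q * s + p * t"
  using assms by (simp add: entropy_term_def ln_div ln_mult algebra_simps)

section \<open>Entropy of the path measures up to a finite time\<close>

lemma space_cylinder_algebra [simp]: "space (cylinder_algebra n) = UNIV"
  by (simp add: cylinder_algebra_def space_measure_of_conv)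

lemma sets_cylinder_algebra:
  "sets (cylinder_algebra n) = sigma_sets UNIV {cylinder w |w. length w = n}"
  by (simp add: cylinder_algebra_def sets_measure_of_conv)

lemma subalgebra_cylinder_algebra:
  assumes "sets P = sets path_borel"
  shows "subalgebra P (cylinder_algebra n)"
proof -
  have "space P = UNIV"
    using sets_eq_imp_space_eq[OF assms] by simp
  moreover have "sigma_sets (space P) {cylinder w |w. length w = n} \<subseteq> sets P"
    by (rule sets.sigma_sets_subset) (auto simp: assms)
  ultimately show ?thesis
    by (simp add: subalgebra_def sets_cylinder_algebra)
qed

lemma measurable_cylinder_algebra_prefix:
  "(\<lambda>\<sigma> :: nat \<Rightarrow> 'e::countable option. map \<sigma> [0..<n]) \<in> cylinder_algebra n \<rightarrow>\<^sub>M count_space UNIV"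
proof -
  have "(\<lambda>\<sigma> :: nat \<Rightarrow> 'e option. map \<sigma> [0..<n]) -` {w} \<in> sets (cylinder_algebra n)" for w
  proof (cases "length w = n")
    case True
    then have "(\<lambda>\<sigma>. map \<sigma> [0..<n]) -` {w} = cylinder w"
      by (auto simp: cylinder_eq)
    then show ?thesis
      using True by (auto simp: sets_cylinder_algebra)
  next
    case False
    then have "(\<lambda>\<sigma>. map \<sigma> [0..<n]) -` {w} = {}" by auto
    then show ?thesis by simp
  qed
  then show ?thesis
    by (subst measurable_count_space_eq2_countable) auto
qed

text \<open>The cylinders of length \<open>n\<close> form a countable partition, and distinct ones
  are disjoint, so their masses determine a measure on the sigma-algebra that they generate.\<close>

lemma cylinder_algebra_measure_eqI:
  fixes P Q :: "(nat \<Rightarrow> 'e::countable option) measure"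
  assumes sets: "sets P = sets (cylinder_algebra n)" "sets Q = sets (cylinder_algebra n)"
    and eq: "\<And>w. length w = n \<Longrightarrow> emeasure P (cylinder w) = emeasure Q (cylinder w)"
    and fin: "\<And>w. length w = n \<Longrightarrow> emeasure P (cylinder w) \<noteq> \<infinity>"
  shows "P = Q"
proof (rule measure_eqI_generator_eq_countable[where
      E = "insert {} {cylinder w |w. length w = n}" and \<Omega> = UNIV and A = "{cylinder w |w. length w = n}"])
  show "Int_stable (insert {} {cylinder w |w :: 'e option list. length w = n})"
  proof -
    have "cylinder v \<inter> cylinder w \<in> {cylinder v, {}}"
      if "length v = length w" for v w :: "'e option list"
      using that by (auto simp: cylinder_eq)
    then show ?thesis
      unfolding Int_stable_def by (fastforce simp only: insert_iff empty_iff mem_Collect_eq Int_empty_left Int_empty_right)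
  qed
  have "sigma_sets UNIV (insert {} {cylinder w |w :: 'e option list. length w = n}) =
      sigma_sets UNIV {cylinder w |w. length w = n}"
    by (intro sigma_sets_eqI) (blast intro: sigma_sets.intros)+
  then show "sets P = sigma_sets UNIV (insert {} {cylinder w |w. length w = n})"
      "sets Q = sigma_sets UNIV (insert {} {cylinder w |w. length w = n})"
    by (simp_all add: sets sets_cylinder_algebra)
  have "\<sigma> \<in> cylinder (map \<sigma> [0..<n])" for \<sigma> :: "nat \<Rightarrow> 'e option"
    by (simp add: cylinder_eq)
  then show "\<Union>{cylinder w |w :: 'e option list. length w = n} = UNIV"
    by (metis (mono_tags, lifting) UNIV_eq_I UnionI length_map length_upt diff_zero mem_Collect_eq)
  have "countable (cylinder ` {w :: 'e option list. length w = n})"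
    by simp
  then show "countable {cylinder w |w :: 'e option list. length w = n}"
    by (simp add: image_Collect[symmetric] setcompr_eq_image)
qed (use eq fin in auto)

section \<open>Positive systems and the densities on finitely many letters\<close>

locale positive_markov = markov M for M :: "('k::complete_space, 'e::countable, 'n) markov_system" +
  assumes positive: "positive_system M"
begin

lemma eprob_pos_iff: "0 < eprob M e u \<longleftrightarrow> u \<in> vset M (ini M e)"
  using positive eprob_pos_imp by (auto simp: positive_system_def)

lemma eprob_eq_0_iff: "eprob M e u = 0 \<longleftrightarrow> u \<notin> vset M (ini M e)"
  using eprob_pos_iff[of e u] eprob_nonneg[of e u] by linarith

lemma vset_unique: "u \<in> vset M i \<Longrightarrow> u \<in> vset M j \<Longrightarrow> i = j"
  using disjoint_vset by (auto simp: disjoint_family_on_def)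

lemma eprob_bar_pos_iff:
  "0 < eprob_bar M c u \<longleftrightarrow> (\<exists>e. c = Some e \<and> u \<in> vset M (ini M e))"
  by (cases c) (auto simp: eprob_pos_iff)

text \<open>By positivity the vertex of a point decides which letters are possible, and a letter
  decides the next vertex. Two points of one vertex set therefore admit the same words and stay in
  common vertex sets along them.\<close>

lemma path_prob_pos_same_vertex:
  assumes "u \<in> vset M i" "v \<in> vset M i" "0 < path_prob M u w"
  shows "0 < path_prob M v w"
    and "\<exists>j. fold (emap_bar M) w u \<in> vset M j \<and> fold (emap_bar M) w v \<in> vset M j"
proof -
  have "0 < path_prob M v w \<and> (\<exists>j. fold (emap_bar M) w u \<in> vset M j \<and> fold (emap_bar M) w v \<in> vset M j)"
    using assms
  proof (induction w arbitrary: u v i)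
    case (Cons c w)
    have "0 < eprob_bar M c u" and pos: "0 < path_prob M (emap_bar M c u) w"
      using Cons.prems(3) eprob_bar_nonneg[of c u] path_prob_nonneg[of "emap_bar M c u" w]
      by (auto simp: zero_less_mult_iff)
    then obtain e where c: "c = Some e" and "u \<in> vset M (ini M e)"
      by (auto simp: eprob_bar_pos_iff)
    then have "i = ini M e"
      using Cons.prems(1) vset_unique by blast
    then have "emap_bar M c u \<in> vset M (ter M e)" "emap_bar M c v \<in> vset M (ter M e)"
        "0 < eprob_bar M c v"
      using Cons.prems c by (auto simp: emap_vset eprob_pos_iff)
    then show ?case
      using Cons.IH[OF _ _ pos, of "ter M e" "emap_bar M c v"] by auto
  qed auto
  then show "0 < path_prob M v w"
    "\<exists>j. fold (emap_bar M) w u \<in> vset M j \<and> fold (emap_bar M) w v \<in> vset M j" by auto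
qed

lemma path_prob_eq_0_iff:
  assumes "u \<in> vset M i" "v \<in> vset M i"
  shows "path_prob M u w = 0 \<longleftrightarrow> path_prob M v w = 0"
  using path_prob_pos_same_vertex(1)[of u i v w] path_prob_pos_same_vertex(1)[of v i u w] assms
    path_prob_nonneg[of u w] path_prob_nonneg[of v w] by linarith

text \<open>The quotient is a function of the prefix, so it suffices to test it as a density on
  cylinders of length \<open>n\<close>; almost sure uniqueness of the Radon-Nikodym derivative does
  the rest.\<close>

lemma AE_density_ratio:
  assumes "x \<in> vset M i" "y \<in> vset M i"
  shows "AE \<sigma> in path_measure M y. density_ratio n (path_measure M x) (path_measure M y) \<sigma> =
    path_prob M x (map \<sigma> [0..<n]) / path_prob M y (map \<sigma> [0..<n])"
proof -
  let ?F = "cylinder_algebra n"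
  let ?P = "restr_to_subalg (path_measure M x) ?F"
  let ?Q = "restr_to_subalg (path_measure M y) ?F"
  define z where "z w = path_prob M x w / path_prob M y w" for w
  have sub: "subalgebra (path_measure M u) ?F" for u
    by (rule subalgebra_cylinder_algebra[OF sets_path_measure])
  have setsF: "sets (restr_to_subalg (path_measure M u) ?F) = sets ?F" for u
    by (rule sets_restr_to_subalg[OF sub])
  interpret Q: prob_space ?Q
    by (rule prob_space_restr_to_subalg[OF sub prob_space_path_measure])
  have meas: "(\<lambda>\<sigma>. h (map \<sigma> [0..<n])) \<in> borel_measurable ?F" for h :: "'e option list \<Rightarrow> ennreal"
    by (rule measurable_compose[OF measurable_cylinder_algebra_prefix]) simp
  have cyl: "cylinder w \<in> sets ?F" if "length w = n" for w :: "'e option list"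
    using that by (auto simp: sets_cylinder_algebra)
  have measQ: "(\<lambda>\<sigma>. h (map \<sigma> [0..<n])) \<in> borel_measurable ?Q" for h :: "'e option list \<Rightarrow> ennreal"
    by (rule measurable_in_subalg[OF sub meas])
  have emP: "emeasure ?P (cylinder w) = ennreal (path_prob M x w)" if "length w = n" for w
    using emeasure_restr_to_subalg[OF sub cyl[OF that]] by (simp add: emeasure_path_measure)
  have "density ?Q (\<lambda>\<sigma>. ennreal (z (map \<sigma> [0..<n]))) = ?P"
  proof (rule cylinder_algebra_measure_eqI[symmetric])
    fix w :: "'e option list" assume w: "length w = n"
    show "emeasure ?P (cylinder w) \<noteq> \<infinity>"
      by (simp add: emP w)
    have "emeasure (density ?Q (\<lambda>\<sigma>. ennreal (z (map \<sigma> [0..<n])))) (cylinder w)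
        = (\<integral>\<^sup>+\<sigma>. ennreal (z (map \<sigma> [0..<n])) * indicator (cylinder w) \<sigma> \<partial>?Q)"
      using cyl[OF w] by (intro emeasure_density measQ) (simp add: setsF)
    also have "\<dots> = (\<integral>\<^sup>+\<sigma>. ennreal (z (map \<sigma> [0..<n])) * indicator {w} (map \<sigma> [0..<n]) \<partial>?Q)"
      using w by (intro nn_integral_cong) (auto simp: cylinder_eq split: split_indicator)
    also have "\<dots> = (\<integral>\<^sup>+\<sigma>. ennreal (z (map \<sigma> [0..<n])) * indicator {w} (map \<sigma> [0..<n]) \<partial>path_measure M y)"
      by (rule nn_integral_subalgebra2[OF sub meas[of "\<lambda>v. ennreal (z v) * indicator {w} v"]])
    also have "\<dots> = (\<integral>\<^sup>+v. ennreal (path_prob M y v) * (ennreal (z v) * indicator {w} v)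
        \<partial>count_space {w. length w = n})"
      by (rule nn_integral_prefix)
    also have "\<dots> = ennreal (path_prob M y w) * ennreal (z w)"
      using w by (subst nn_integral_count_space'[of "{w}"]) auto
    \<comment> \<open>If \<open>path_prob M y w = 0\<close>, division by zero gives
      \<open>z w = 0\<close>, and the equality holds because \<open>path_prob M x w\<close> vanishes
      too.\<close>
    also have "\<dots> = ennreal (path_prob M x w)"
      using path_prob_eq_0_iff[OF assms, of w]
      by (simp add: z_def path_prob_nonneg ennreal_mult[symmetric])
    finally show "emeasure ?P (cylinder w) =
        emeasure (density ?Q (\<lambda>\<sigma>. ennreal (z (map \<sigma> [0..<n])))) (cylinder w)"
      by (simp add: emP w)
  qed (simp_all add: setsF)
  then have "AE \<sigma> in ?Q. ennreal (z (map \<sigma> [0..<n])) = RN_deriv ?Q ?P \<sigma>"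
    by (intro Q.RN_deriv_unique measQ)
  then have "AE \<sigma> in path_measure M y. ennreal (z (map \<sigma> [0..<n])) = RN_deriv ?Q ?P \<sigma>"
    by (rule AE_restr_to_subalg[OF sub])
  then show ?thesis
  proof eventually_elim
    case (elim \<sigma>)
    have "0 \<le> z (map \<sigma> [0..<n])"
      by (simp add: z_def path_prob_nonneg)
    then show ?case
      by (simp add: density_ratio_def elim[symmetric] z_def)
  qed
qed

definition entropy_sum :: "nat \<Rightarrow> 'k \<Rightarrow> 'k \<Rightarrow> ennreal" where
  "entropy_sum n x y = (\<integral>\<^sup>+w. ennreal (entropy_term (path_prob M x w) (path_prob M y w))
     \<partial>count_space {w. length w = n})"

text \<open>\<open>A\<close> and \<open>N\<close> are the integrals of the positive and negative
  parts of \<open>z ln z\<close>. Since \<open>z\<close> has integral 1, replacing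
  \<open>z ln z\<close> by the non-negative \<open>z ln z - z + 1\<close> leaves
  \<open>A - N\<close> unchanged.\<close>

lemma entropy_upto_eq:
  assumes "x \<in> vset M i" "y \<in> vset M i"
  shows "entropy_upto n (path_measure M x) (path_measure M y) = enn2ereal (entropy_sum n x y)"
proof -
  let ?Q = "path_measure M y"
  define z where "z w = path_prob M x w / path_prob M y w" for w
  define g where "g w = z w * ln (z w)" for w
  define A where "A = (\<integral>\<^sup>+\<sigma>. ennreal (g (map \<sigma> [0..<n])) \<partial>?Q)"
  define N where "N = (\<integral>\<^sup>+\<sigma>. ennreal (- g (map \<sigma> [0..<n])) \<partial>?Q)"
  interpret Q: prob_space ?Q by (rule prob_space_path_measure)
  interpret P: prob_space "path_measure M x" by (rule prob_space_path_measure)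
  have [measurable]: "(\<lambda>\<sigma>. h (map \<sigma> [0..<n])) \<in> borel_measurable ?Q" for h :: "_ \<Rightarrow> ennreal"
    by (subst measurable_cong_sets[OF sets_path_measure refl]) (rule measurable_of_prefix, simp)
  have z_nonneg: "0 \<le> z w" for w
    by (simp add: z_def path_prob_nonneg)
  \<comment> \<open>This is non-negativity of \<open>entropy_term (z w) 1\<close>; at
    \<open>z w = 0\<close> the product \<open>z w * ln (z w)\<close> is 0, as the convention for
    \<open>0 log 0\<close> demands.\<close>
  have g_ge: "z w - 1 \<le> g w" for w
    using z_nonneg[of w] entropy_term_nonneg[of "z w" 1] by (cases "z w = 0") (auto simp: g_def entropy_term_def)
  have zero: "path_prob M y w = 0 \<Longrightarrow> path_prob M x w = 0" for w
    using path_prob_eq_0_iff[OF assms] by simp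
  have qz: "path_prob M y w * z w = path_prob M x w" for w
    using zero[of w] by (simp add: z_def)
  have "AE \<sigma> in ?Q. (if density_ratio n (path_measure M x) ?Q \<sigma> = 0 then 0
      else density_ratio n (path_measure M x) ?Q \<sigma> * ln (density_ratio n (path_measure M x) ?Q \<sigma>))
      = g (map \<sigma> [0..<n])"
    using AE_density_ratio[OF assms, of n] by eventually_elim (simp add: g_def z_def)
  then have "entropy_upto n (path_measure M x) ?Q = enn2ereal A - enn2ereal N"
    unfolding entropy_upto_def ereal_integral_def A_def N_def
    by (intro arg_cong2[where f = "(-)"] arg_cong[where f = enn2ereal] nn_integral_cong_AE)
      (auto elim!: eventually_mono)
  moreover have "A = N + entropy_sum n x y"
  proof -
    have 1: "(\<integral>\<^sup>+\<sigma>. ennreal (z (map \<sigma> [0..<n])) \<partial>?Q) = 1"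
    proof -
      have "(\<integral>\<^sup>+\<sigma>. ennreal (z (map \<sigma> [0..<n])) \<partial>?Q) =
          (\<integral>\<^sup>+w. ennreal (path_prob M x w) * 1 \<partial>count_space {w. length w = n})"
        by (subst nn_integral_prefix[where h = "\<lambda>w. ennreal (z w)"])
          (simp add: ennreal_mult[symmetric] path_prob_nonneg z_nonneg qz)
      also have "\<dots> = (\<integral>\<^sup>+\<sigma>. 1 \<partial>path_measure M x)"
        by (rule nn_integral_prefix[symmetric])
      finally show ?thesis using P.emeasure_space_1 by simp
    qed
    have 2: "(\<integral>\<^sup>+\<sigma>. ennreal (g (map \<sigma> [0..<n]) - z (map \<sigma> [0..<n]) + 1) \<partial>?Q) = entropy_sum n x y"
      unfolding entropy_sum_def
    proof (subst nn_integral_prefix[where h = "\<lambda>w. ennreal (g w - z w + 1)"], intro nn_integral_cong)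
      fix w :: "'e option list"
      have "path_prob M y w * (g w - z w + 1) = entropy_term (path_prob M x w) (path_prob M y w)"
        using qz[of w] zero[of w] by (auto simp: g_def z_def entropy_term_def field_simps)
      moreover have "0 \<le> g w - z w + 1"
        using g_ge[of w] by simp
      ultimately show "ennreal (path_prob M y w) * ennreal (g w - z w + 1) =
          ennreal (entropy_term (path_prob M x w) (path_prob M y w))"
        by (simp add: ennreal_mult[symmetric] path_prob_nonneg)
    qed
    \<comment> \<open>Adding 1 keeps every term non-negative: the positive part of \<open>g\<close>
      plus 1 equals its negative part plus \<open>g - z + 1\<close> plus \<open>z\<close>.\<close>
    have "A + 1 = (\<integral>\<^sup>+\<sigma>. ennreal (g (map \<sigma> [0..<n])) + 1 \<partial>?Q)"
      unfolding A_def using Q.emeasure_space_1 by (subst nn_integral_add) auto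
    also have "\<dots> = (\<integral>\<^sup>+\<sigma>. ennreal (- g (map \<sigma> [0..<n])) +
        ennreal (g (map \<sigma> [0..<n]) - z (map \<sigma> [0..<n]) + 1) + ennreal (z (map \<sigma> [0..<n])) \<partial>?Q)"
    proof (intro nn_integral_cong)
      fix \<sigma> :: "nat \<Rightarrow> 'e option"
      let ?w = "map \<sigma> [0..<n]"
      have *: "ennreal (g ?w - z ?w + 1) + ennreal (z ?w) = ennreal (g ?w + 1)"
        using g_ge[of ?w] z_nonneg[of ?w] by (subst ennreal_plus[symmetric]) auto
      show "ennreal (g ?w) + 1 = ennreal (- g ?w) + ennreal (g ?w - z ?w + 1) + ennreal (z ?w)"
      proof (cases "0 \<le> g ?w")
        case True
        then show ?thesis
          by (simp add: add.assoc * ennreal_neg)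
      next
        case False
        then have "ennreal (- g ?w) + ennreal (g ?w + 1) = 1"
          using g_ge[of ?w] z_nonneg[of ?w] by (subst ennreal_plus[symmetric]) auto
        then show ?thesis
          using False by (simp only: add.assoc *) (simp add: ennreal_neg)
      qed
    qed
    also have "\<dots> = N + entropy_sum n x y + 1"
      unfolding N_def 1[symmetric] 2[symmetric] by (simp add: nn_integral_add)
    finally show ?thesis
      by (simp add: ennreal_add_right_cancel)
  qed
  \<comment> \<open>Finiteness of \<open>N\<close> excludes the difference of two infinities; the
    bound comes from \<open>g \<ge> z - 1 \<ge> -1\<close>.\<close>
  moreover have "N \<le> 1"
  proof -
    have "N \<le> (\<integral>\<^sup>+\<sigma>. 1 \<partial>?Q)"
      unfolding N_def
    proof (intro nn_integral_mono)
      fix \<sigma> :: "nat \<Rightarrow> 'e option"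
      show "ennreal (- g (map \<sigma> [0..<n])) \<le> 1"
        using g_ge[of "map \<sigma> [0..<n]"] z_nonneg[of "map \<sigma> [0..<n]"]
        by (simp add: ennreal_1[symmetric] del: ennreal_1)
    qed
    then show ?thesis using Q.emeasure_space_1 by simp
  qed
  then have "\<exists>r. enn2ereal N = ereal r"
    by (cases N rule: ennreal_cases) (auto simp: enn2ereal_ennreal top_unique)
  ultimately show ?thesis
    by (cases "enn2ereal (entropy_sum n x y)") (auto simp: plus_ennreal.rep_eq)
qed

section \<open>The chain rule\<close>

definition step_entropy :: "'k \<Rightarrow> 'k \<Rightarrow> ennreal" where
  "step_entropy u v =
    (\<integral>\<^sup>+c. ennreal (entropy_term (eprob_bar M c u) (eprob_bar M c v)) \<partial>count_space UNIV)"

text \<open>Summing \<open>entropy_term_mult\<close> over all letters leaves \<open>q + p\<close> on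
  both sides, because both letter laws have mass 1; these finite terms cancel.\<close>

lemma nn_integral_entropy_term_mult:
  assumes "0 < p" "0 < q" and uv: "u \<in> vset M j" "v \<in> vset M j"
  shows "(\<integral>\<^sup>+c. ennreal (entropy_term (p * eprob_bar M c u) (q * eprob_bar M c v)) \<partial>count_space UNIV)
    = ennreal (entropy_term p q) + ennreal p * step_entropy u v" (is "?L = ?R")
proof -
  have nonneg: "0 \<le> entropy_term p q"
    using assms by (intro entropy_term_nonneg)
  have "ennreal (eprob_bar M c u) * ennreal (entropy_term p q) +
      ennreal p * ennreal (entropy_term (eprob_bar M c u) (eprob_bar M c v)) +
      ennreal q * ennreal (eprob_bar M c v) + ennreal p * ennreal (eprob_bar M c u) =
      ennreal (entropy_term (p * eprob_bar M c u) (q * eprob_bar M c v)) +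
      ennreal q * ennreal (eprob_bar M c u) + ennreal p * ennreal (eprob_bar M c v)"
    (is "?l c = ?r c") for c
  proof (cases "0 < eprob_bar M c u")
    case True
    then obtain e where c: "c = Some e" "u \<in> vset M (ini M e)"
      by (auto simp: eprob_bar_pos_iff)
    then have "v \<in> vset M (ini M e)"
      using uv vset_unique by blast
    then have "0 < eprob_bar M c v"
      using c by (simp add: eprob_pos_iff)
    then show ?thesis
      using entropy_term_mult[OF assms(1,2) True, of "eprob_bar M c v"] True assms(1,2) nonneg
        entropy_term_nonneg[OF True, of "eprob_bar M c v"]
        entropy_term_nonneg[of "p * eprob_bar M c u" "q * eprob_bar M c v"]
      by (simp add: ennreal_mult[symmetric] ennreal_plus[symmetric] del: ennreal_plus)
  next
    case False
    \<comment> \<open>Because \<open>u\<close> and \<open>v\<close> share a vertex, a letter that is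
      impossible at \<open>u\<close> is impossible at \<open>v\<close>, and all terms
      vanish.\<close>
    then have "\<not> 0 < eprob_bar M c v"
      using uv vset_unique by (auto simp: eprob_bar_pos_iff)
    then have "eprob_bar M c u = 0" "eprob_bar M c v = 0"
      using False eprob_bar_nonneg[of c u] eprob_bar_nonneg[of c v] by auto
    then show ?thesis by simp
  qed
  then have "(\<integral>\<^sup>+c. ?l c \<partial>count_space UNIV) = (\<integral>\<^sup>+c. ?r c \<partial>count_space UNIV)"
    by simp
  then have "?R + ennreal q + ennreal p = ?L + ennreal q + ennreal p"
    by (simp add: nn_integral_add nn_integral_cmult nn_integral_multc nn_integral_eprob_bar step_entropy_def)
  then show ?thesis
    by (simp add: ennreal_add_right_cancel)
qed

text \<open>Splitting off the last letter separates the entropy of the prefix from that of the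
  transition, weighted by the probability of the prefix under \<open>path_measure M x\<close>. Words
  of probability zero contribute nothing to either side.\<close>

lemma entropy_sum_Suc:
  assumes "x \<in> vset M i" "y \<in> vset M i"
  shows "entropy_sum (Suc n) x y = entropy_sum n x y +
    (\<integral>\<^sup>+\<sigma>. step_entropy (path_map M \<sigma> n x) (path_map M \<sigma> n y) \<partial>path_measure M x)"
proof -
  let ?f = "\<lambda>w. fold (emap_bar M) w"
  have "entropy_sum (Suc n) x y = (\<integral>\<^sup>+w. \<integral>\<^sup>+c. ennreal (entropy_term
      (path_prob M x w * eprob_bar M c (?f w x)) (path_prob M y w * eprob_bar M c (?f w y)))
      \<partial>count_space UNIV \<partial>count_space {w. length w = n})"
    by (simp add: entropy_sum_def nn_integral_count_space_words_Suc path_prob_append)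
  also have "\<dots> = (\<integral>\<^sup>+w. ennreal (entropy_term (path_prob M x w) (path_prob M y w)) +
      ennreal (path_prob M x w) * step_entropy (?f w x) (?f w y) \<partial>count_space {w. length w = n})"
  proof (intro nn_integral_cong)
    fix w :: "'e option list"
    show "(\<integral>\<^sup>+c. ennreal (entropy_term (path_prob M x w * eprob_bar M c (?f w x))
        (path_prob M y w * eprob_bar M c (?f w y))) \<partial>count_space UNIV) =
        ennreal (entropy_term (path_prob M x w) (path_prob M y w)) +
        ennreal (path_prob M x w) * step_entropy (?f w x) (?f w y)"
    proof (cases "path_prob M x w = 0")
      case True
      then show ?thesis
        using path_prob_eq_0_iff[OF assms, of w] by simp
    next
      case False
      then have pos: "0 < path_prob M x w"
        using path_prob_nonneg[of x w] by simp
      then obtain j where "?f w x \<in> vset M j" "?f w y \<in> vset M j"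
        using path_prob_pos_same_vertex(2)[OF assms] by blast
      then show ?thesis
        by (intro nn_integral_entropy_term_mult pos path_prob_pos_same_vertex(1)[OF assms pos])
    qed
  qed
  also have "\<dots> = entropy_sum n x y +
      (\<integral>\<^sup>+w. ennreal (path_prob M x w) * step_entropy (?f w x) (?f w y) \<partial>count_space {w. length w = n})"
    by (simp add: entropy_sum_def nn_integral_add)
  also have "\<dots> = entropy_sum n x y +
    (\<integral>\<^sup>+\<sigma>. step_entropy (path_map M \<sigma> n x) (path_map M \<sigma> n y) \<partial>path_measure M x)"
    unfolding path_map_eq_fold
    by (subst nn_integral_prefix[where h = "\<lambda>w. step_entropy (?f w x) (?f w y)"]) simp
  finally show ?thesis .
qed

lemma entropy_sum_eq:
  assumes "x \<in> vset M i" "y \<in> vset M i"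
  shows "entropy_sum n x y = (\<Sum>k<n.
    \<integral>\<^sup>+\<sigma>. step_entropy (path_map M \<sigma> k x) (path_map M \<sigma> k y) \<partial>path_measure M x)"
proof (induction n)
  case 0
  have "(\<integral>\<^sup>+w. ennreal (entropy_term (path_prob M x w) (path_prob M y w)) \<partial>count_space {[]}) = 0"
    by (simp add: nn_integral_count_space_finite)
  then show ?case
    by (simp add: entropy_sum_def)
qed (simp add: entropy_sum_Suc[OF assms])

text \<open>The entropies up to time \<open>n\<close> are partial sums of a series in
  \<open>[0,\<infinity>]\<close>. Such a series converges, so \<open>lim\<close> denotes a genuine
  limit.\<close>

lemma relative_entropy_eq:
  assumes "x \<in> vset M i" "y \<in> vset M i"
  shows "relative_entropy (path_measure M x) (path_measure M y) = enn2ereal (\<Sum>k.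
    \<integral>\<^sup>+\<sigma>. step_entropy (path_map M \<sigma> k x) (path_map M \<sigma> k y) \<partial>path_measure M x)"
  (is "_ = enn2ereal (suminf ?D)")
proof -
  have "(\<lambda>n. \<Sum>k<n. ?D k) \<longlonglongrightarrow> suminf ?D"
    by (intro summable_LIMSEQ summableI)
  then have "(\<lambda>n. enn2ereal (\<Sum>k<n. ?D k)) \<longlonglongrightarrow> enn2ereal (suminf ?D)"
    by (rule tendsto_enn2erealI)
  then show ?thesis
    by (simp add: relative_entropy_def entropy_upto_eq[OF assms] entropy_sum_eq[OF assms] limI)
qed

section \<open>Bounds for the entropy of a single step\<close>

text \<open>Edges with another initial vertex have probability zero at both points, and the others
  are bounded by \<open>entropy_term_le\<close>. The function \<open>g\<close> leaves room for two
  bounds of the numerators: the constant 1 and the modulus of continuity.\<close>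

lemma step_entropy_le:
  assumes uv: "u \<in> vset M j" "v \<in> vset M j"
    and g: "\<And>e. ini M e = j \<Longrightarrow> ennreal (\<bar>eprob M e u - eprob M e v\<bar>) \<le> g e"
  shows "step_entropy u v \<le> (\<Sum>\<^sub>\<infinity>e\<in>{e. ini M e = j}. (g e)\<^sup>2 / ennreal (eprob M e v))"
proof -
  have "step_entropy u v =
      (\<integral>\<^sup>+e. ennreal (entropy_term (eprob M e u) (eprob M e v)) \<partial>count_space UNIV)"
    unfolding step_entropy_def by (subst nn_integral_count_space_option) auto
  also have "\<dots> = (\<integral>\<^sup>+e. ennreal (entropy_term (eprob M e u) (eprob M e v)) \<partial>count_space {e. ini M e = j})"
  proof (rule nn_integral_count_space_eq)
    fix e assume "e \<in> UNIV - {e. ini M e = j}"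
    then have "u \<notin> vset M (ini M e)" "v \<notin> vset M (ini M e)"
      using uv vset_unique by auto
    then have "eprob M e u = 0" "eprob M e v = 0"
      by (simp_all add: eprob_eq_0_iff)
    then show "ennreal (entropy_term (eprob M e u) (eprob M e v)) = 0"
      by simp
  qed simp
  also have "\<dots> \<le> (\<integral>\<^sup>+e. (g e)\<^sup>2 / ennreal (eprob M e v) \<partial>count_space {e. ini M e = j})"
  proof (intro nn_integral_mono)
    fix e assume "e \<in> space (count_space {e. ini M e = j})"
    then have e: "ini M e = j" by simp
    then have pos: "0 < eprob M e u" "0 < eprob M e v"
      using uv by (simp_all add: eprob_pos_iff)
    have "ennreal (entropy_term (eprob M e u) (eprob M e v)) \<le>
        ennreal (\<bar>eprob M e u - eprob M e v\<bar>\<^sup>2 / eprob M e v)"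
      using entropy_term_le[OF pos] by (intro ennreal_leI) simp
    also have "\<dots> = (ennreal \<bar>eprob M e u - eprob M e v\<bar>)\<^sup>2 / ennreal (eprob M e v)"
      using pos by (simp only: ennreal_power abs_ge_zero divide_ennreal zero_le_power)
    also have "\<dots> \<le> (g e)\<^sup>2 / ennreal (eprob M e v)"
      using g[OF e] by (intro divide_right_mono_ennreal power_mono) auto
    finally show "ennreal (entropy_term (eprob M e u) (eprob M e v)) \<le> (g e)\<^sup>2 / ennreal (eprob M e v)" .
  qed
  finally show ?thesis
    by (simp add: infsum_eq_nn_integral_count_space)
qed

lemma step_entropy_le_inv_prob_sup:
  assumes "u \<in> vset M j" "v \<in> vset M j"
  shows "step_entropy u v \<le> inv_prob_sup M j"
proof -
  have "\<bar>eprob M e u - eprob M e v\<bar> \<le> 1" for e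
    using eprob_nonneg[of e u] eprob_nonneg[of e v] eprob_le_1[of e u] eprob_le_1[of e v] by linarith
  then have "step_entropy u v \<le> (\<Sum>\<^sub>\<infinity>e\<in>{e. ini M e = j}. 1\<^sup>2 / ennreal (eprob M e v))"
    using assms by (intro step_entropy_le) auto
  also have "\<dots> \<le> inv_prob_sup M j"
    unfolding inv_prob_sup_def power_one by (rule SUP_upper) fact
  finally show ?thesis .
qed

text \<open>The pair \<open>(u, v)\<close> competes in the supremum defining \<open>modulus\<close>,
  and \<open>v\<close> in the one defining \<open>modulus_sup\<close>.\<close>

lemma step_entropy_le_modulus_sup:
  assumes "u \<in> vset M j" "v \<in> vset M j" "dist u v \<le> a powr (\<beta> * real k) * dist x y"
  shows "step_entropy u v \<le> modulus_sup M a \<beta> x y k j"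
proof -
  have "step_entropy u v \<le> (\<Sum>\<^sub>\<infinity>e\<in>{e. ini M e = j}.
      (modulus M e (a powr (\<beta> * real k) * dist x y))\<^sup>2 / ennreal (eprob M e v))"
    using assms by (intro step_entropy_le)
      (auto simp: modulus_def intro!: SUP_upper2[where i = "(u, v)"])
  also have "\<dots> \<le> modulus_sup M a \<beta> x y k j"
    unfolding modulus_sup_def by (rule SUP_upper) fact
  finally show ?thesis .
qed

section \<open>Almost sure properties and measurability of sets of paths\<close>

lemma AE_path_prob_pos: "AE \<sigma> in path_measure M u. \<forall>n. 0 < path_prob M u (map \<sigma> [0..<n])"
  unfolding AE_all_countable
proof
  fix n
  let ?Z = "{w :: 'e option list. path_prob M u w = 0}"
  have "(\<integral>\<^sup>+\<sigma>. indicator ?Z (map \<sigma> [0..<n]) \<partial>path_measure M u) =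
      (\<integral>\<^sup>+w. ennreal (path_prob M u w) * indicator ?Z w \<partial>count_space {w. length w = n})"
    by (rule nn_integral_prefix)
  also have "\<dots> = (\<integral>\<^sup>+w. 0 \<partial>count_space {w :: 'e option list. length w = n})"
    by (intro nn_integral_cong) (auto split: split_indicator)
  finally have "(\<integral>\<^sup>+\<sigma>. indicator ?Z (map \<sigma> [0..<n]) \<partial>path_measure M u) = 0"
    by simp
  moreover have "(\<lambda>\<sigma>. indicator ?Z (map \<sigma> [0..<n]) :: ennreal) \<in> borel_measurable (path_measure M u)"
    by (subst measurable_cong_sets[OF sets_path_measure refl]) (rule measurable_of_prefix, simp)
  ultimately have "AE \<sigma> in path_measure M u. (indicator ?Z (map \<sigma> [0..<n]) :: ennreal) = 0"
    by (subst (asm) nn_integral_0_iff_AE)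
  then show "AE \<sigma> in path_measure M u. 0 < path_prob M u (map \<sigma> [0..<n])"
    by eventually_elim (use path_prob_nonneg in \<open>auto simp: less_le split: split_indicator_asm\<close>)
qed

text \<open>If all prefixes have positive probability, each letter is an edge that starts at the
  vertex of the current point. This point lies in the terminal vertex set of the preceding edge, and
  vertex sets are disjoint.\<close>

lemma AE_graph_paths: "AE \<sigma> in path_measure M u. \<sigma> \<in> graph_paths M"
  using AE_path_prob_pos[of u]
proof eventually_elim
  case (elim \<sigma>)
  have step: "0 < eprob_bar M (\<sigma> n) (path_map M \<sigma> n u)" for n
    using elim[THEN spec, of "Suc n"] elim[THEN spec, of n]
    by (simp add: path_prob_append path_map_eq_fold zero_less_mult_iff)
  have "\<sigma> n \<noteq> None \<and> ini M (the (\<sigma> (Suc n))) = ter M (the (\<sigma> n))" for n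
  proof -
    obtain e where e: "\<sigma> n = Some e" "path_map M \<sigma> n u \<in> vset M (ini M e)"
      using step[of n] by (auto simp: eprob_bar_pos_iff)
    obtain e' where e': "\<sigma> (Suc n) = Some e'" "path_map M \<sigma> (Suc n) u \<in> vset M (ini M e')"
      using step[of "Suc n"] by (auto simp: eprob_bar_pos_iff simp del: path_map.simps)
    have "path_map M \<sigma> (Suc n) u \<in> vset M (ter M e)"
      using e by (simp add: emap_vset)
    then show ?thesis
      using e(1) e' vset_unique by auto
  qed
  then show ?case
    by (simp add: graph_paths_def)
qed

lemma sets_graph_paths: "graph_paths M \<in> sets path_borel"
proof -
  have "Measurable.pred path_borel
      (\<lambda>\<sigma>. \<sigma> n \<noteq> None \<and> ini M (the (\<sigma> (Suc n))) = ter M (the (\<sigma> n)))" for n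
  proof -
    \<comment> \<open>The condition involves the letters at positions \<open>n\<close> and
      \<open>Suc n\<close>, hence a prefix of length \<open>Suc (Suc n)\<close>.\<close>
    have "(\<lambda>\<sigma>. (\<lambda>w. w ! n \<noteq> None \<and> ini M (the (w ! Suc n)) = ter M (the (w ! n)))
        (map \<sigma> [0..<Suc (Suc n)])) \<in> path_borel \<rightarrow>\<^sub>M count_space UNIV"
      by (rule measurable_of_prefix) simp
    then show ?thesis
      by (simp add: nth_append del: upt_Suc)
  qed
  then have "Measurable.pred path_borel
      (\<lambda>\<sigma>. \<forall>n. \<sigma> n \<noteq> None \<and> ini M (the (\<sigma> (Suc n))) = ter M (the (\<sigma> n)))"
    by (rule pred_intros_countable)
  then show ?thesis
    by (simp add: graph_paths_def pred_def)
qed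

lemma sets_expanding_paths: "expanding_paths M a \<beta> x y k \<in> sets path_borel"
proof -
  have "Measurable.pred path_borel
      (\<lambda>\<sigma>. dist (path_map M \<sigma> k x) (path_map M \<sigma> k y) > a powr (\<beta> * real k) * dist x y)"
    unfolding path_map_eq_fold
    by (rule measurable_of_prefix[where h = "\<lambda>w. dist (fold (emap_bar M) w x) (fold (emap_bar M) w y)
          > a powr (\<beta> * real k) * dist x y"]) simp
  then have "graph_paths M \<inter>
      {\<sigma>. dist (path_map M \<sigma> k x) (path_map M \<sigma> k y) > a powr (\<beta> * real k) * dist x y} \<in> sets path_borel"
    by (intro sets.Int sets_graph_paths) (simp add: pred_def)
  then show ?thesis
    unfolding expanding_paths_def Collect_conj_eq Collect_mem_eq
    by (simp only: sets_graph_paths sets.empty_sets split: if_split) simp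
qed

section \<open>Comparison with one term of the bound\<close>

text \<open>The estimate holds path by path before integration: the indicators of the vertex sets
  select the vertex of the current point. Tonelli then exchanges the sum over the countably many
  vertices with the integral.\<close>

lemma nn_integral_step_entropy_le:
  assumes xy: "x \<in> vset M i" "y \<in> vset M i" and "0 < a"
  shows "(\<integral>\<^sup>+\<sigma>. step_entropy (path_map M \<sigma> k x) (path_map M \<sigma> k y) \<partial>path_measure M x) \<le>
    (\<Sum>\<^sub>\<infinity>j. inv_prob_sup M j *
          (\<integral>\<^sup>+\<sigma>\<in>expanding_paths M a \<beta> x y k.
             indicator (vset M j) (path_map M \<sigma> k x) \<partial>path_measure M x) +
        modulus_sup M a \<beta> x y k j *
          emeasure ((markov_adj M ^^ k) (return borel x)) (vset M j))"
proof -
  let ?P = "path_measure M x"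
  let ?A = "expanding_paths M a \<beta> x y k"
  define I where "I j \<sigma> = (indicator (vset M j) (path_map M \<sigma> k x) :: ennreal)" for j \<sigma>
  note [measurable] = sets_expanding_paths
  have [measurable]: "I j \<in> borel_measurable ?P" for j
    unfolding I_def by measurable
  have distribution: "emeasure ((markov_adj M ^^ k) (return borel x)) (vset M j) = (\<integral>\<^sup>+\<sigma>. I j \<sigma> \<partial>?P)" for j
  proof -
    have "(\<integral>\<^sup>+\<sigma>. I j \<sigma> \<partial>?P) = (\<integral>\<^sup>+v. indicator (vset M j) v \<partial>distr ?P borel (\<lambda>\<sigma>. path_map M \<sigma> k x))"
      unfolding I_def by (rule nn_integral_distr[symmetric]) auto
    then show ?thesis
      by (simp add: markov_adj_iterate)
  qed
  have "AE \<sigma> in ?P. step_entropy (path_map M \<sigma> k x) (path_map M \<sigma> k y) \<le>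
      (\<integral>\<^sup>+j. inv_prob_sup M j * (I j \<sigma> * indicator ?A \<sigma>) + modulus_sup M a \<beta> x y k j * I j \<sigma>
        \<partial>count_space UNIV)"
    using AE_path_prob_pos[of x] AE_graph_paths[of x]
  proof eventually_elim
    case (elim \<sigma>)
    obtain j where j: "path_map M \<sigma> k x \<in> vset M j" "path_map M \<sigma> k y \<in> vset M j"
      using path_prob_pos_same_vertex(2)[OF xy] elim(1) unfolding path_map_eq_fold by blast
    have "step_entropy (path_map M \<sigma> k x) (path_map M \<sigma> k y) \<le>
        inv_prob_sup M j * (I j \<sigma> * indicator ?A \<sigma>) + modulus_sup M a \<beta> x y k j * I j \<sigma>"
    proof (cases "\<sigma> \<in> ?A")
      case True
      then have "step_entropy (path_map M \<sigma> k x) (path_map M \<sigma> k y) \<le>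
          inv_prob_sup M j * (I j \<sigma> * indicator ?A \<sigma>)"
        using step_entropy_le_inv_prob_sup[OF j] j by (simp add: I_def)
      then show ?thesis
        by (rule add_increasing2[rotated]) simp
    next
      case False
      \<comment> \<open>For \<open>k = 0\<close> this is an equality, since
        \<open>a powr 0 = 1\<close> for positive \<open>a\<close>, however the expanding set is
        defined there. For \<open>k > 0\<close> the path lies in \<open>graph_paths M\<close>, so
        only the distance condition can keep it out of \<open>?A\<close>.\<close>
      have "dist (path_map M \<sigma> k x) (path_map M \<sigma> k y) \<le> a powr (\<beta> * real k) * dist x y"
        using False elim(2) \<open>0 < a\<close> by (cases "k = 0") (auto simp: expanding_paths_def)
      then show ?thesis
        using step_entropy_le_modulus_sup[OF j] j False by (simp add: I_def)
    qed
    also have "\<dots> \<le> (\<integral>\<^sup>+j. inv_prob_sup M j * (I j \<sigma> * indicator ?A \<sigma>) + modulus_sup M a \<beta> x y k j * I j \<sigma>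
        \<partial>count_space UNIV)"
      by (rule nn_integral_ge_point) simp
    finally show ?case .
  qed
  then have "(\<integral>\<^sup>+\<sigma>. step_entropy (path_map M \<sigma> k x) (path_map M \<sigma> k y) \<partial>?P) \<le>
      (\<integral>\<^sup>+\<sigma>. \<integral>\<^sup>+j. inv_prob_sup M j * (I j \<sigma> * indicator ?A \<sigma>) + modulus_sup M a \<beta> x y k j * I j \<sigma>
        \<partial>count_space UNIV \<partial>?P)"
    by (rule nn_integral_mono_AE)
  also have "\<dots> = (\<integral>\<^sup>+j. \<integral>\<^sup>+\<sigma>. inv_prob_sup M j * (I j \<sigma> * indicator ?A \<sigma>) +
      modulus_sup M a \<beta> x y k j * I j \<sigma> \<partial>?P \<partial>count_space UNIV)"
    by (intro nn_integral_count_space_nn_integral countable_vertices) measurable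
  also have "\<dots> = (\<integral>\<^sup>+j. inv_prob_sup M j * (\<integral>\<^sup>+\<sigma>. I j \<sigma> * indicator ?A \<sigma> \<partial>?P) +
      modulus_sup M a \<beta> x y k j * (\<integral>\<^sup>+\<sigma>. I j \<sigma> \<partial>?P) \<partial>count_space UNIV)"
    by (simp add: nn_integral_add nn_integral_cmult)
  finally show ?thesis
    unfolding infsum_eq_nn_integral_count_space[OF countable_vertices] distribution
    by (simp only: I_def[abs_def])
qed

end

theorem lemma8:
  fixes M :: "('k::complete_space, 'e::countable, 'n) markov_system"
    and a \<beta> :: real and x y :: 'k and i :: 'n
  assumes "is_markov_system M"
    and "positive_system M"
    and "contractive_system M a"
    and "0 \<le> \<beta>" and "\<beta> \<le> 1"
    and "x \<in> vset M i" and "y \<in> vset M i"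
  shows "relative_entropy (path_measure M x) (path_measure M y)
           \<le> enn2ereal (ennreal_sqrt (entropy_bound M a \<beta> x y) + entropy_bound M a \<beta> x y)"
proof -
  interpret positive_markov M
    by unfold_locales fact+
  have "0 < a"
    using assms(3) by (simp add: contractive_system_def)
  have "(\<Sum>k. \<integral>\<^sup>+\<sigma>. step_entropy (path_map M \<sigma> k x) (path_map M \<sigma> k y) \<partial>path_measure M x)
      \<le> entropy_bound M a \<beta> x y"
    unfolding entropy_bound_def
    by (intro suminf_le nn_integral_step_entropy_le[OF assms(6,7) \<open>0 < a\<close>] summableI)
  also have "\<dots> \<le> ennreal_sqrt (entropy_bound M a \<beta> x y) + entropy_bound M a \<beta> x y"
    by (rule add_increasing) simp_all
  finally show ?thesis
    by (simp add: relative_entropy_eq[OF assms(6,7)] less_eq_ennreal.rep_eq)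
qed

end
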